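(* Suppose a group $G$ admits a geometric (i.e. proper and cocompact) action on a geodesic (Gromov-)hyperbolic space $(Y,d)$. Then $G$ is growth tight with respect to the metric $d$; that is, for every infinite normal subgroup $\Gamma$ of $G$, with $\bar G=G/\Gamma$, one has $\delta_G>\delta_{\bar G}$.
   Context: Actions are by isometries. The action is proper if $\{g\in G: d(o,go)\le n\}$ is finite for all $o\in Y$ and $n\ge 0$. Growth rates: fix $o\in Y$ and set $B(o,n)=\{go: g\in G,\ d(o,go)\le n\}$. For $A\subset G$, $\delta_A=\limsup_{n\to\infty} n^{-1}\ln \sharp(B(o,n)\cap Ao)$ (independent of $o$). For a normal subgroup $\Gamma$ of $G$, $\bar G=G/\Gamma$ acts on $\bar Y=Y/\Gamma$ by $\Gamma g\cdot \Gamma x=\Gamma gx$; equip $\bar Y$ with the quotient metric $\bar d(\Gamma x,\Gamma y)=d(\Gamma x,\Gamma y)$ (the distance between the two orbits). Then $\delta_{\bar G}$ is the growth rate of $\bar G$ for this action, relative to $\bar d$.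
   Formalization: The group G is additionally assumed not to be virtually cyclic; without this the claim fails, e.g. for G = Γ = Z acting on the real line by translations, where both growth rates are 0. *)

theory Defs
  imports "HOL-Analysis.Analysis" "HOL-Algebra.Algebra"
begin

section \<open>Geodesic hyperbolic metric spaces\<close>

definition geodesic ::
  "'a set \<Rightarrow> ('a \<Rightarrow> 'a \<Rightarrow> real) \<Rightarrow> (real \<Rightarrow> 'a) \<Rightarrow> 'a \<Rightarrow> 'a \<Rightarrow> bool" where
  "geodesic Y d \<gamma> x y \<longleftrightarrow>
     \<gamma> 0 = x \<and> \<gamma> (d x y) = y \<and> \<gamma> ` {0..d x y} \<subseteq> Y \<and>
     (\<forall>s\<in>{0..d x y}. \<forall>t\<in>{0..d x y}. d (\<gamma> s) (\<gamma> t) = \<bar>s - t\<bar>)"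

definition geodesic_space :: "'a set \<Rightarrow> ('a \<Rightarrow> 'a \<Rightarrow> real) \<Rightarrow> bool" where
  "geodesic_space Y d \<longleftrightarrow>
     Metric_space Y d \<and> (\<forall>x\<in>Y. \<forall>y\<in>Y. \<exists>\<gamma>. geodesic Y d \<gamma> x y)"

text \<open>Rips' condition: every geodesic triangle is \<open>\<delta>\<close>-slim.  As the vertices range over all
  of \<open>Y\<close> and geodesics can be reversed, it suffices to require this of one side of each triangle.\<close>

definition gromov_hyperbolic :: "'a set \<Rightarrow> ('a \<Rightarrow> 'a \<Rightarrow> real) \<Rightarrow> bool" where
  "gromov_hyperbolic Y d \<longleftrightarrow>
     (\<exists>\<delta>\<ge>0. \<forall>x\<in>Y. \<forall>y\<in>Y. \<forall>z\<in>Y. \<forall>\<alpha> \<beta> \<gamma>.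
        geodesic Y d \<alpha> x y \<longrightarrow> geodesic Y d \<beta> y z \<longrightarrow> geodesic Y d \<gamma> x z \<longrightarrow>
        (\<forall>p \<in> \<alpha> ` {0..d x y}. \<exists>q \<in> \<beta> ` {0..d y z} \<union> \<gamma> ` {0..d x z}. d p q \<le> \<delta>))"

section \<open>Geometric actions\<close>

definition isometric_action ::
  "('g, 'm) monoid_scheme \<Rightarrow> 'a set \<Rightarrow> ('a \<Rightarrow> 'a \<Rightarrow> real) \<Rightarrow> ('g \<Rightarrow> 'a \<Rightarrow> 'a) \<Rightarrow> bool" where
  "isometric_action G Y d \<phi> \<longleftrightarrow>
     group_action G Y \<phi> \<and>
     (\<forall>g\<in>carrier G. \<forall>x\<in>Y. \<forall>y\<in>Y. d (\<phi> g x) (\<phi> g y) = d x y)"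

definition proper_action ::
  "('g, 'm) monoid_scheme \<Rightarrow> 'a set \<Rightarrow> ('a \<Rightarrow> 'a \<Rightarrow> real) \<Rightarrow> ('g \<Rightarrow> 'a \<Rightarrow> 'a) \<Rightarrow> bool" where
  "proper_action G Y d \<phi> \<longleftrightarrow>
     (\<forall>b\<in>Y. \<forall>r::real. r \<ge> 0 \<longrightarrow> finite {g \<in> carrier G. d b (\<phi> g b) \<le> r})"

definition cocompact_action ::
  "('g, 'm) monoid_scheme \<Rightarrow> 'a set \<Rightarrow> ('a \<Rightarrow> 'a \<Rightarrow> real) \<Rightarrow> ('g \<Rightarrow> 'a \<Rightarrow> 'a) \<Rightarrow> bool" where
  "cocompact_action G Y d \<phi> \<longleftrightarrow>
     (\<exists>K. compactin (Metric_space.mtopology Y d) K \<and> (\<Union>g\<in>carrier G. \<phi> g ` K) = Y)"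

definition geometric_action ::
  "('g, 'm) monoid_scheme \<Rightarrow> 'a set \<Rightarrow> ('a \<Rightarrow> 'a \<Rightarrow> real) \<Rightarrow> ('g \<Rightarrow> 'a \<Rightarrow> 'a) \<Rightarrow> bool" where
  "geometric_action G Y d \<phi> \<longleftrightarrow>
     isometric_action G Y d \<phi> \<and> proper_action G Y d \<phi> \<and> cocompact_action G Y d \<phi>"

text \<open>Finite groups are virtually cyclic in this sense (take \<open>a = \<one>\<close>).  For infinite
  virtually cyclic groups growth tightness fails, since every growth rate vanishes; a group acting
  geometrically on a hyperbolic space is non-elementary iff it is not virtually cyclic.\<close>

definition virtually_cyclic :: "('g, 'm) monoid_scheme \<Rightarrow> bool" where
  "virtually_cyclic G \<longleftrightarrow> (\<exists>a\<in>carrier G. finite (rcosets\<^bsub>G\<^esub> (generate G {a})))"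

section \<open>Growth rates\<close>

definition orbit_ball ::
  "('g, 'm) monoid_scheme \<Rightarrow> ('a \<Rightarrow> 'a \<Rightarrow> real) \<Rightarrow> ('g \<Rightarrow> 'a \<Rightarrow> 'a) \<Rightarrow> 'a \<Rightarrow> nat \<Rightarrow> 'a set" where
  "orbit_ball G d \<phi> b n = {\<phi> g b | g. g \<in> carrier G \<and> d b (\<phi> g b) \<le> real n}"

text \<open>The growth rate of a set \<open>A\<close> of elements of \<open>G\<close>.  The term for \<open>n = 0\<close> is a division
  by zero, which does not affect the limit superior.\<close>

definition growth_rate ::
  "('g, 'm) monoid_scheme \<Rightarrow> ('a \<Rightarrow> 'a \<Rightarrow> real) \<Rightarrow> ('g \<Rightarrow> 'a \<Rightarrow> 'a) \<Rightarrow> 'a \<Rightarrow> 'g set \<Rightarrow> ereal" where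
  "growth_rate G d \<phi> b A =
     limsup (\<lambda>n. ereal (ln (real (card (orbit_ball G d \<phi> b n \<inter> (\<lambda>g. \<phi> g b) ` A))) / real n))"

section \<open>The quotient by a normal subgroup\<close>

abbreviation sub_orbit :: "('g, 'm) monoid_scheme \<Rightarrow> ('g \<Rightarrow> 'a \<Rightarrow> 'a) \<Rightarrow> 'g set \<Rightarrow> 'a \<Rightarrow> 'a set" where
  "sub_orbit G \<phi> \<Gamma> x \<equiv> orbit (G\<lparr>carrier := \<Gamma>\<rparr>) \<phi> x"

definition orbit_dist :: "('a \<Rightarrow> 'a \<Rightarrow> real) \<Rightarrow> 'a set \<Rightarrow> 'a set \<Rightarrow> real" where
  "orbit_dist d p q = (INF (x, y) \<in> p \<times> q. d x y)"

text \<open>The action of \<open>G Mod \<Gamma>\<close> on the set of \<open>\<Gamma>\<close>-orbits: the elementwise product of the coset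
  \<open>\<Gamma>g\<close> with the orbit \<open>\<Gamma>x\<close> is the orbit \<open>\<Gamma>gx\<close>, as the lemma below confirms.\<close>

definition quotient_action :: "('g \<Rightarrow> 'a \<Rightarrow> 'a) \<Rightarrow> 'g set \<Rightarrow> 'a set \<Rightarrow> 'a set" where
  "quotient_action \<phi> C p = (\<Union>h\<in>C. \<phi> h ` p)"

lemma quotient_action_coset:
  assumes act: "group_action G Y \<phi>" and N: "\<Gamma> \<lhd> G" and g: "g \<in> carrier G" and x: "x \<in> Y"
  shows "quotient_action \<phi> (\<Gamma> #>\<^bsub>G\<^esub> g) (sub_orbit G \<phi> \<Gamma> x) = sub_orbit G \<phi> \<Gamma> (\<phi> g x)"
proof -
  interpret A: group_action G Y \<phi> by (rule act)
  interpret N: normal \<Gamma> G by (rule N)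
  have comp: "\<phi> a (\<phi> b x) = \<phi> (a \<otimes>\<^bsub>G\<^esub> b) x" if "a \<in> carrier G" "b \<in> carrier G" for a b
    using A.composition_rule[OF x that] by simp
  show ?thesis
  proof (intro equalityI subsetI)
    fix z assume "z \<in> quotient_action \<phi> (\<Gamma> #>\<^bsub>G\<^esub> g) (sub_orbit G \<phi> \<Gamma> x)"
    then obtain h k where hk: "h \<in> \<Gamma>" "k \<in> \<Gamma>" and z: "z = \<phi> (h \<otimes>\<^bsub>G\<^esub> g) (\<phi> k x)"
      by (auto simp: quotient_action_def orbit_def r_coset_def)
    have "g \<otimes>\<^bsub>G\<^esub> k \<in> \<Gamma> #>\<^bsub>G\<^esub> g"
      using N.coset_eq g hk(2) by (auto simp: l_coset_def)
    then obtain l where l: "l \<in> \<Gamma>" "g \<otimes>\<^bsub>G\<^esub> k = l \<otimes>\<^bsub>G\<^esub> g"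
      by (auto simp: r_coset_def)
    have "z = \<phi> (h \<otimes>\<^bsub>G\<^esub> g \<otimes>\<^bsub>G\<^esub> k) x"
      using z comp[of "h \<otimes>\<^bsub>G\<^esub> g" k] hk g N.subset by auto
    also have "h \<otimes>\<^bsub>G\<^esub> g \<otimes>\<^bsub>G\<^esub> k = (h \<otimes>\<^bsub>G\<^esub> l) \<otimes>\<^bsub>G\<^esub> g"
      using hk g l N.mem_carrier by (simp add: N.m_assoc)
    also have "\<phi> \<dots> x = \<phi> (h \<otimes>\<^bsub>G\<^esub> l) (\<phi> g x)"
      using comp[of "h \<otimes>\<^bsub>G\<^esub> l" g] hk g l N.mem_carrier by simp
    finally show "z \<in> sub_orbit G \<phi> \<Gamma> (\<phi> g x)"
      using hk l by (auto simp: orbit_def)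
  next
    fix z assume "z \<in> sub_orbit G \<phi> \<Gamma> (\<phi> g x)"
    then obtain h where h: "h \<in> \<Gamma>" and z: "z = \<phi> h (\<phi> g x)"
      by (auto simp: orbit_def)
    have "z = \<phi> (h \<otimes>\<^bsub>G\<^esub> g) (\<phi> \<one>\<^bsub>G\<^esub> x)"
      using z comp[of h g] comp[of "h \<otimes>\<^bsub>G\<^esub> g" "\<one>\<^bsub>G\<^esub>"] h g N.mem_carrier by simp
    moreover have "h \<otimes>\<^bsub>G\<^esub> g \<in> \<Gamma> #>\<^bsub>G\<^esub> g"
      using h by (auto simp: r_coset_def)
    moreover have "\<phi> \<one>\<^bsub>G\<^esub> x \<in> sub_orbit G \<phi> \<Gamma> x"
      using N.one_closed by (auto simp: orbit_def)
    ultimately show "z \<in> quotient_action \<phi> (\<Gamma> #>\<^bsub>G\<^esub> g) (sub_orbit G \<phi> \<Gamma> x)"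
      unfolding quotient_action_def by blast
  qed
qed

definition quotient_growth_rate ::
  "('g, 'm) monoid_scheme \<Rightarrow> ('a \<Rightarrow> 'a \<Rightarrow> real) \<Rightarrow> ('g \<Rightarrow> 'a \<Rightarrow> 'a) \<Rightarrow> 'a \<Rightarrow> 'g set \<Rightarrow> ereal" where
  "quotient_growth_rate G d \<phi> b \<Gamma> =
     growth_rate (G Mod \<Gamma>) (orbit_dist d) (quotient_action \<phi>) (sub_orbit G \<phi> \<Gamma> b)
       (carrier (G Mod \<Gamma>))"

definition growth_tight ::
  "('g, 'm) monoid_scheme \<Rightarrow> ('a \<Rightarrow> 'a \<Rightarrow> real) \<Rightarrow> ('g \<Rightarrow> 'a \<Rightarrow> 'a) \<Rightarrow> 'a \<Rightarrow> bool" where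
  "growth_tight G d \<phi> b \<longleftrightarrow>
     (\<forall>\<Gamma>. \<Gamma> \<lhd> G \<and> infinite \<Gamma> \<longrightarrow>
        growth_rate G d \<phi> b (carrier G) > quotient_growth_rate G d \<phi> b \<Gamma>)"

end

theory Submission
  imports Defs
begin

text \<open>Fix the base point \<open>b\<close> and measure \<open>g\<close> by \<open>len g = d b (\<phi> g b)\<close>. Choose a shortest
  representative in every coset of \<open>\<Gamma>\<close>; these representatives count the quotient, and none of
  them fellow-travels a translate of a long element \<open>h\<close> of \<open>\<Gamma>\<close>, since conjugating \<open>h\<close> would shorten
  it. As \<open>G\<close> is not virtually cyclic, it contains two independent loxodromic elements, whose high
  powers form a finite set \<open>U\<close> such that any two elements can be joined through some \<open>u \<in> U\<close>
  without cancellation. Hence the products of blocks \<open>v a u h\<close>, with \<open>a\<close> in a separated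
  set of shortest representatives and \<open>u, v \<in> U\<close> depending on \<open>a\<close>, are broken geodesics, and the
  blocks generate a free semigroup: a longer first letter \<open>a'\<close> of the same product would have to
  travel along the translate \<open>a u h\<close> of \<open>h\<close>.
  The counting function of the quotient is submultiplicative, so its Poincare series diverges at
  its exponent \<open>\<sigma>\<close>; inserting \<open>u\<close>, \<open>v\<close> and \<open>h\<close> costs a constant factor only, so the series of the
  free semigroup still diverges slightly beyond \<open>\<sigma>\<close>.\<close>

text \<open>The order of the choices carries the proof. The cancellation bound \<open>C\<close> is
  found first and does not depend on how long the elements of \<open>U\<close> are; then come
  \<open>U\<close>, \<open>h\<close> and the separation radius, and only then the finite alphabet
  \<open>A\<close>. Thinning out the representatives and inserting \<open>u\<close>,
  \<open>v\<close>, \<open>h\<close> therefore cost factors fixed before \<open>A\<close>, which a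
  divergent series can pay for and a convergent one might not. Hence \<sigma> is an infimum as in
  Fekete's lemma: \<open>exp (\<sigma> * n)\<close> is then a lower bound for every
  \<open>n\<close>, not only up to subexponential factors. If \<sigma> = 0 the quotient may be
  finite and its series a finite sum. In that case two elements of \<open>U\<close> serve as the
  alphabet, each of weight 1. Geometry enters through Gromov products alone: "little cancels in g k"
  is an upper bound on \<open>gp (inv g) k\<close>, and "the way to y passes near g" is a lower
  bound on \<open>gp g y\<close> close to \<open>len g\<close>. Nearly every step is a four-point
  inequality in which one of the two alternatives is excluded because some piece is long.\<close>

lemma sum_prod_list_lists:
  fixes w :: "'b \<Rightarrow> real"
  assumes "finite A"
  shows "(\<Sum>xs | set xs \<subseteq> A \<and> length xs = n. prod_list (map w xs)) = sum w A ^ n"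
proof (induction n)
  case 0
  have "{xs. set xs \<subseteq> A \<and> length xs = 0} = {[]}" by auto
  then show ?case by simp
next
  case (Suc n)
  let ?L = "\<lambda>n. {xs. set xs \<subseteq> A \<and> length xs = n}"
  have "(\<Sum>xs\<in>?L (Suc n). prod_list (map w xs)) = (\<Sum>(xs, a)\<in>?L n \<times> A. prod_list (map w (a # xs)))"
    by (subst lists_length_Suc_eq, subst sum.reindex) (auto simp: inj_on_def case_prod_unfold)
  also have "\<dots> = (\<Sum>xs\<in>?L n. \<Sum>a\<in>A. w a * prod_list (map w xs))"
    using assms finite_lists_length_eq[OF assms] by (subst sum.cartesian_product) auto
  also have "\<dots> = sum w A ^ Suc n"
    unfolding Suc[symmetric] power_Suc sum_product by (rule sum.swap)
  finally show ?case .
qed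

section \<open>Gromov products of group elements\<close>

text \<open>The action reduced to one orbit: \<open>len (inv g \<otimes> h)\<close> plays the
  distance from g b to h b, a left-invariant pseudometric, so the four-point inequality at the base
  point passes to every orbit point. \<open>coarse_geodesic\<close> replaces the points of a
  geodesic by orbit points, with error \<open>R\<close>.\<close>

locale hyperbolic_length = group G for G (structure) +
  fixes len :: "'a \<Rightarrow> real" and \<Delta> R :: real
  assumes len_one [simp]: "len \<one> = 0"
    and len_inv [simp]: "g \<in> carrier G \<Longrightarrow> len (inv g) = len g"
    and len_mult: "g \<in> carrier G \<Longrightarrow> h \<in> carrier G \<Longrightarrow> len (g \<otimes> h) \<le> len g + len h"
    and finite_ball: "finite {g \<in> carrier G. len g \<le> r}"
    and \<Delta>_nonneg: "0 \<le> \<Delta>" and R_nonneg: "0 \<le> R"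
    and four_point_raw: "\<lbrakk>g \<in> carrier G; h \<in> carrier G; k \<in> carrier G\<rbrakk> \<Longrightarrow>
      min ((len g + len h - len (inv g \<otimes> h)) / 2) ((len h + len k - len (inv h \<otimes> k)) / 2) - \<Delta>
        \<le> (len g + len k - len (inv g \<otimes> k)) / 2"
    and coarse_geodesic: "\<lbrakk>g \<in> carrier G; 0 \<le> t; t \<le> len g\<rbrakk> \<Longrightarrow>
      \<exists>k\<in>carrier G. len k \<le> t + R \<and> len (inv k \<otimes> g) \<le> len g - t + R"
begin

text \<open>The Gromov product of \<open>g b\<close> and \<open>h b\<close> based at \<open>b\<close>.\<close>

definition gp :: "'a \<Rightarrow> 'a \<Rightarrow> real" where
  "gp g h = (len g + len h - len (inv g \<otimes> h)) / 2"

lemma inv_mult_cancel [simp]: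
  assumes "x \<in> carrier G" "y \<in> carrier G"
  shows "inv x \<otimes> (x \<otimes> y) = y" "x \<otimes> (inv x \<otimes> y) = y"
  using assms by (simp_all flip: m_assoc)

lemma len_nonneg: "g \<in> carrier G \<Longrightarrow> 0 \<le> len g"
  using len_mult[of g "inv g"] by simp

lemma len_inv_mult_commute:
  assumes "g \<in> carrier G" "h \<in> carrier G"
  shows "len (inv g \<otimes> h) = len (inv h \<otimes> g)"
  using assms len_inv[of "inv g \<otimes> h"] by (simp add: inv_mult_group)

lemma gp_commute: "g \<in> carrier G \<Longrightarrow> h \<in> carrier G \<Longrightarrow> gp g h = gp h g"
  by (simp add: gp_def len_inv_mult_commute)

lemma gp_one [simp]: "g \<in> carrier G \<Longrightarrow> gp g \<one> = 0" "g \<in> carrier G \<Longrightarrow> gp \<one> g = 0"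
  by (simp_all add: gp_def)

lemma gp_same [simp]: "g \<in> carrier G \<Longrightarrow> gp g g = len g"
  by (simp add: gp_def)

lemma gp_bounds:
  assumes "g \<in> carrier G" "h \<in> carrier G"
  shows "0 \<le> gp g h" "gp g h \<le> len g" "gp g h \<le> len h"
  using assms len_mult[of "inv g" h] len_mult[of g "inv g \<otimes> h"] len_mult[of h "inv h \<otimes> g"]
  by (simp_all add: gp_def len_inv_mult_commute[of g h])

lemma four_point:
  assumes "g \<in> carrier G" "h \<in> carrier G" "k \<in> carrier G"
  shows "gp g h - \<Delta> \<le> gp g k \<or> gp h k - \<Delta> \<le> gp g k"
  using four_point_raw[OF assms] by (auto simp: gp_def min_def split: if_splits)

text \<open>\<open>gp (inv g) k\<close> is the Gromov product of b and g k b seen from g b, that is,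
  the amount cancelled in g k. The products seen from the two ends of a side add up to its
  length.\<close>

lemma gp_mult_self:
  "g \<in> carrier G \<Longrightarrow> k \<in> carrier G \<Longrightarrow> gp g (g \<otimes> k) = len g - gp (inv g) k"
  by (simp add: gp_def field_simps)

lemma len_mult_eq:
  "g \<in> carrier G \<Longrightarrow> k \<in> carrier G \<Longrightarrow> len (g \<otimes> k) = len g + len k - 2 * gp (inv g) k"
  by (simp add: gp_def field_simps)

lemma len_inv_mult_eq:
  "g \<in> carrier G \<Longrightarrow> k \<in> carrier G \<Longrightarrow> len (inv g \<otimes> k) = len g + len k - 2 * gp g k"
  by (simp add: gp_def field_simps)

text \<open>Translating both points by \<open>g\<close> amounts to moving the base point by the
  distance \<open>len g\<close>.\<close>

lemma gp_translate:
  assumes "g \<in> carrier G" "x \<in> carrier G" "y \<in> carrier G"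
  shows "gp (g \<otimes> x) (g \<otimes> y) \<le> gp x y + len g" "gp x y - len g \<le> gp (g \<otimes> x) (g \<otimes> y)"
proof -
  have "inv (g \<otimes> x) \<otimes> (g \<otimes> y) = inv x \<otimes> y"
    using assms by (simp add: inv_mult_group m_assoc)
  moreover have "len x \<le> len g + len (g \<otimes> x)" "len y \<le> len g + len (g \<otimes> y)"
    using assms len_mult[of "inv g" "g \<otimes> x"] len_mult[of "inv g" "g \<otimes> y"] by simp_all
  ultimately show "gp (g \<otimes> x) (g \<otimes> y) \<le> gp x y + len g"
    "gp x y - len g \<le> gp (g \<otimes> x) (g \<otimes> y)"
    using assms len_mult[of g x] len_mult[of g y] by (simp_all add: gp_def field_simps)
qed

lemma gp_mult_right:
  assumes "g \<in> carrier G" "x \<in> carrier G" "y \<in> carrier G"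
  shows "gp x (y \<otimes> g) \<le> gp x y + len g"
proof -
  have "len (inv x \<otimes> y) \<le> len (inv x \<otimes> (y \<otimes> g)) + len g"
    using assms len_mult[of "inv x \<otimes> (y \<otimes> g)" "inv g"] by (simp add: m_assoc)
  then show ?thesis
    using assms len_mult[of y g] by (simp add: gp_def field_simps)
qed

section \<open>Concatenation without cancellation\<close>

abbreviation product :: "'a list \<Rightarrow> 'a" where
  "product gs \<equiv> foldr (\<otimes>) gs \<one>"

lemma product_closed [simp]: "set gs \<subseteq> carrier G \<Longrightarrow> product gs \<in> carrier G"
  by (induction gs) auto

text \<open>\<open>C\<close> bounds the cancellation at each joint and \<open>K\<close> the length
  of each piece from below. Once \<open>K\<close> is large compared with \<open>C\<close>, this
  local condition controls the whole product.\<close>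

fun broken_geodesic :: "real \<Rightarrow> real \<Rightarrow> 'a list \<Rightarrow> bool" where
  "broken_geodesic C K [] \<longleftrightarrow> True"
| "broken_geodesic C K [g] \<longleftrightarrow> K \<le> len g"
| "broken_geodesic C K (g # h # gs) \<longleftrightarrow>
     K \<le> len g \<and> gp (inv g) h \<le> C \<and> broken_geodesic C K (h # gs)"

text \<open>By induction the product of the tail follows its first letter \<open>h\<close> for at
  least \<open>K - C - \<Delta>\<close>. Since \<open>h\<close> leaves \<open>inv g\<close> after
  \<open>C\<close>, the tail must leave it there too. The bound C + \<Delta> reproduces itself, so
  errors do not accumulate along the word.\<close>

lemma broken_geodesic_head:
  assumes "broken_geodesic C K (g # gs)" "set (g # gs) \<subseteq> carrier G" "2 * C + 2 * \<Delta> < K" "0 \<le> C"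
  shows "gp (inv g) (product gs) \<le> C + \<Delta>"
  using assms
proof (induction gs arbitrary: g)
  case Nil
  then show ?case using \<Delta>_nonneg by simp
next
  case (Cons h gs)
  have 1: "gp (inv h) (product gs) \<le> C + \<Delta>"
    using Cons by (cases gs) auto
  have "K \<le> len h" using Cons.prems by (cases gs) auto
  moreover have "gp h (h \<otimes> product gs) = len h - gp (inv h) (product gs)"
    using Cons.prems by (intro gp_mult_self) auto
  moreover have "gp (inv g) h \<le> C" using Cons.prems by auto
  moreover have "gp (inv g) (h \<otimes> product gs) - \<Delta> \<le> gp (inv g) h \<or> gp (h \<otimes> product gs) h - \<Delta> \<le> gp (inv g) h"
    using Cons.prems by (intro four_point) auto
  moreover have "gp (h \<otimes> product gs) h = gp h (h \<otimes> product gs)"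
    using Cons.prems by (intro gp_commute) auto
  ultimately show ?case using 1 Cons.prems by auto
qed

text \<open>The same argument read backwards, from the joint towards the start: the inverse of a
  prefix follows the inverse of its last letter. Each letter passed costs one \<Delta>.\<close>

lemma broken_geodesic_three:
  assumes cl: "a \<in> carrier G" "u \<in> carrier G" "h \<in> carrier G" "z \<in> carrier G"
    and K: "K \<le> len u" "K \<le> len h" "2 * C + 3 * \<Delta> < K"
    and gp: "gp (inv a) u \<le> C" "gp (inv u) h \<le> C" "gp (inv h) z \<le> C + \<Delta>"
  shows "gp (inv (a \<otimes> u)) h \<le> C + \<Delta>" "gp (inv (a \<otimes> u \<otimes> h)) z \<le> C + 2 * \<Delta>"
proof -
  have inv: "inv (a \<otimes> u) = inv u \<otimes> inv a" "inv (a \<otimes> u \<otimes> h) = inv h \<otimes> inv (a \<otimes> u)"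
    using cl by (simp_all add: inv_mult_group m_assoc)
  have "gp (inv u) (inv u \<otimes> inv a) = len u - gp u (inv a)"
    using cl gp_mult_self[of "inv u" "inv a"] by simp
  moreover have "gp u (inv a) = gp (inv a) u" using cl by (simp add: gp_commute)
  moreover have "gp (inv u) (inv (a \<otimes> u)) - \<Delta> \<le> gp (inv u) h \<or> gp (inv (a \<otimes> u)) h - \<Delta> \<le> gp (inv u) h"
    using cl by (intro four_point) auto
  ultimately show 1: "gp (inv (a \<otimes> u)) h \<le> C + \<Delta>"
    using gp K inv \<Delta>_nonneg by auto
  have "gp (inv h) (inv h \<otimes> inv (a \<otimes> u)) = len h - gp h (inv (a \<otimes> u))"
    using cl gp_mult_self[of "inv h" "inv (a \<otimes> u)"] by simp
  moreover have "gp h (inv (a \<otimes> u)) = gp (inv (a \<otimes> u)) h" using cl by (simp add: gp_commute)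
  moreover have "gp (inv h) (inv (a \<otimes> u \<otimes> h)) - \<Delta> \<le> gp (inv h) z \<or>
      gp (inv (a \<otimes> u \<otimes> h)) z - \<Delta> \<le> gp (inv h) z"
    using cl by (intro four_point) auto
  ultimately show "gp (inv (a \<otimes> u \<otimes> h)) z \<le> C + 2 * \<Delta>"
    using 1 gp K inv \<Delta>_nonneg by auto
qed

section \<open>Loxodromic elements\<close>

lemma gp_power_left:
  assumes h: "h \<in> carrier G" and c: "gp (inv h) h \<le> c" "2 * c + 3 * \<Delta> < len h"
  shows "gp (inv h) (h [^] (n::nat)) \<le> c + \<Delta>"
proof (induction n)
  case 0
  have "0 \<le> c" using c gp_bounds(1)[of "inv h" h] h by simp
  then show ?case using h \<Delta>_nonneg by simp
next
  case (Suc n)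
  have eq: "h [^] Suc n = h \<otimes> h [^] n" using h nat_pow_Suc2[of h n] by simp
  have "gp h (h \<otimes> h [^] n) = len h - gp (inv h) (h [^] n)"
    using h by (intro gp_mult_self) auto
  moreover have "gp (inv h) (h [^] Suc n) - \<Delta> \<le> gp (inv h) h \<or> gp (h [^] Suc n) h - \<Delta> \<le> gp (inv h) h"
    using h by (intro four_point) auto
  moreover have "gp (h [^] Suc n) h = gp h (h [^] Suc n)"
    using h by (intro gp_commute) auto
  ultimately show ?case using Suc c \<Delta>_nonneg eq by auto
qed

lemma gp_power_power:
  assumes h: "h \<in> carrier G" and c: "gp (inv h) h \<le> c" "2 * c + 3 * \<Delta> < len h"
  shows "gp (inv h [^] (m::nat)) (h [^] (n::nat)) \<le> c + 2 * \<Delta>"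
proof (cases m)
  case 0
  have "0 \<le> c" using c gp_bounds(1)[of "inv h" h] h by simp
  then show ?thesis using 0 h \<Delta>_nonneg by simp
next
  case (Suc k)
  have "gp h (inv h [^] k) \<le> c + \<Delta>"
    using gp_power_left[of "inv h" c k] h c by (simp add: gp_commute)
  moreover have "inv h [^] m = inv h \<otimes> inv h [^] k" using h Suc nat_pow_Suc2[of "inv h" k] by simp
  moreover have "gp (inv h) (inv h \<otimes> inv h [^] k) = len h - gp h (inv h [^] k)"
    using h gp_mult_self[of "inv h" "inv h [^] k"] by simp
  moreover have "gp (inv h) (h [^] n) \<le> c + \<Delta>" by (rule gp_power_left[OF assms])
  moreover have "gp (inv h) (inv h [^] m) - \<Delta> \<le> gp (inv h) (h [^] n) \<or>
    gp (inv h [^] m) (h [^] n) - \<Delta> \<le> gp (inv h) (h [^] n)"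
    using h by (intro four_point) auto
  ultimately show ?thesis using c by auto
qed

text \<open>Few cancellations in \<open>h \<otimes> h\<close> compared with \<open>len h\<close>
  make the powers of \<open>h\<close> a quasi-geodesic. The summand 1 makes each further factor
  lengthen the power by at least 1, so \<open>h\<close> has infinite order.\<close>

definition loxodromic :: "real \<Rightarrow> 'a \<Rightarrow> bool" where
  "loxodromic c h \<longleftrightarrow> h \<in> carrier G \<and> 0 \<le> c \<and> gp (inv h) h \<le> c \<and> 2 * c + 3 * \<Delta> + 1 < len h"

lemma loxodromicD:
  assumes "loxodromic c h"
  shows "h \<in> carrier G" "0 \<le> c" "gp (inv h) h \<le> c" "2 * c + 3 * \<Delta> < len h"
  using assms by (auto simp: loxodromic_def)

lemma loxodromic_inv: "loxodromic c h \<Longrightarrow> loxodromic c (inv h)"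
  by (auto simp: loxodromic_def gp_commute)

lemma len_power_ge:
  assumes "loxodromic c h"
  shows "real n \<le> len (h [^] n)"
proof (induction n)
  case (Suc n)
  note lox = loxodromicD[OF assms]
  have "len (h \<otimes> h [^] n) = len h + len (h [^] n) - 2 * gp (inv h) (h [^] n)"
    using lox by (intro len_mult_eq) auto
  moreover have "gp (inv h) (h [^] n) \<le> c + \<Delta>"
    using lox by (intro gp_power_left) auto
  moreover have "h [^] Suc n = h \<otimes> h [^] n" using lox nat_pow_Suc2[of h n] by simp
  moreover have "2 * c + 3 * \<Delta> + 1 < len h" using assms by (simp add: loxodromic_def)
  ultimately show ?case using Suc \<Delta>_nonneg by auto
qed (use loxodromicD[OF assms] in simp)

lemma len_int_power_ge:
  assumes "loxodromic c h"
  shows "real_of_int \<bar>i\<bar> \<le> len (h [^] (i::int))"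
proof (cases i rule: int_cases2)
  case (nonneg n)
  then show ?thesis using len_power_ge[OF assms, of n] by (simp add: int_pow_int)
next
  case (nonpos n)
  then show ?thesis using len_power_ge[OF assms, of n] loxodromicD(1)[OF assms]
    by (simp add: int_pow_neg int_pow_int)
qed

text \<open>The powers of \<open>h\<close> replace the points of a geodesic from 1 to
  \<open>h [^] k\<close>: the first power of length at least \<open>t\<close> overshoots by at most
  one factor, and it lies near the way to \<open>h [^] k\<close> because little cancels between the
  two parts of that power.\<close>

lemma power_on_axis:
  assumes lox: "loxodromic c h" and t: "0 \<le> t" "t \<le> len (h [^] (k::nat))"
  obtains j :: nat where "t \<le> len (h [^] j)" "len (h [^] j) \<le> t + len h"
    "len (h [^] j) - c - 2 * \<Delta> \<le> gp (h [^] j) (h [^] k)"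
proof -
  note l = loxodromicD[OF lox]
  define j where "j = (LEAST j. t \<le> len (h [^] (j::nat)))"
  have j: "t \<le> len (h [^] j)" "j \<le> k"
    using t(2) unfolding j_def by (auto intro: LeastI Least_le)
  have up: "len (h [^] j) \<le> t + len h"
  proof (cases j)
    case 0
    then show ?thesis using t l len_nonneg[of h] by simp
  next
    case (Suc i)
    then have "\<not> t \<le> len (h [^] i)" unfolding j_def using not_less_Least lessI by metis
    then show ?thesis using len_mult[of "h [^] i" h] l Suc by simp
  qed
  have "h [^] k = h [^] j \<otimes> h [^] (k - j)"
    using l j by (simp add: nat_pow_mult)
  then have "gp (h [^] j) (h [^] k) = len (h [^] j) - gp (inv (h [^] j)) (h [^] (k - j))"
    using l by (simp add: gp_mult_self)
  moreover have "gp (inv (h [^] j)) (h [^] (k - j)) \<le> c + 2 * \<Delta>"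
    using gp_power_power[OF l(1,3,4)] l by (simp add: nat_pow_inv)
  ultimately show thesis using that[of j] j up by simp
qed

lemma int_power_on_axis:
  assumes lox: "loxodromic c h" and t: "0 \<le> t" "t \<le> len (h [^] (k::int))"
  obtains j :: int where "t \<le> len (h [^] j)" "len (h [^] j) \<le> t + len h"
    "len (h [^] j) - c - 2 * \<Delta> \<le> gp (h [^] j) (h [^] k)"
proof (cases k rule: int_cases2)
  case (nonneg n)
  then obtain j :: nat where "t \<le> len (h [^] j)" "len (h [^] j) \<le> t + len h"
    "len (h [^] j) - c - 2 * \<Delta> \<le> gp (h [^] j) (h [^] n)"
    using power_on_axis[OF lox t(1), of n] t(2) by (auto simp: int_pow_int)
  then show thesis using that[of "int j"] nonneg by (simp add: int_pow_int)
next
  case (nonpos n)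
  note l = loxodromicD[OF lox]
  have neg: "h [^] (- int i) = inv h [^] i" for i
    using l by (simp add: int_pow_neg int_pow_int nat_pow_inv)
  obtain j :: nat where "t \<le> len (inv h [^] j)" "len (inv h [^] j) \<le> t + len h"
    "len (inv h [^] j) - c - 2 * \<Delta> \<le> gp (inv h [^] j) (inv h [^] n)"
    using power_on_axis[OF loxodromic_inv[OF lox] t(1), of n] t(2) nonpos neg l by auto
  then show thesis using that[of "- int j"] nonpos neg by simp
qed

lemma gp_based:
  assumes "k \<in> carrier G" "x \<in> carrier G" "y \<in> carrier G"
  shows "2 * gp (inv k \<otimes> x) (inv k \<otimes> y) = len (inv k \<otimes> x) + len (inv k \<otimes> y) - len (inv x \<otimes> y)"
proof -
  have "inv (inv k \<otimes> x) \<otimes> (inv k \<otimes> y) = inv x \<otimes> y"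
    using assms by (simp add: inv_mult_group m_assoc)
  then show ?thesis by (simp add: gp_def)
qed

lemma exists_long:
  assumes "infinite S" "S \<subseteq> carrier G"
  obtains g where "g \<in> S" "r < len g"
proof (cases "S \<subseteq> {g \<in> carrier G. len g \<le> r}")
  case True
  then show ?thesis using finite_subset[OF True finite_ball] assms by simp
next
  case False
  then obtain g where "g \<in> S" "\<not> len g \<le> r" using assms by blast
  then show ?thesis using that[of g] by simp
qed

text \<open>Pigeonhole along a long coarse geodesic \<kappa>. Seen from \<kappa> s, the points a
  step \<open>m\<close> behind and ahead form one of finitely many pictures, so two times s < t
  share a picture. The element taking \<kappa> s to \<kappa> t then continues the direction of
  travel, and so little cancels in its square.\<close>

lemma exists_loxodromic:
  assumes inf: "infinite (carrier G)"
  obtains h where "loxodromic (5 * R + 4 * \<Delta>) h"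
proof -
  note nn = \<Delta>_nonneg R_nonneg
  \<comment> \<open>Large enough that \<open>m - 2 * R\<close>, the lower bound for
    \<open>len h\<close> below, meets the length required of a loxodromic element with constant 5 R
    + 4 \<Delta>, and that following a direction for about \<open>m\<close> contradicts the bounds
    on diverging ones.\<close>
  define m where "m = 20 * R + 20 * \<Delta> + 2"
  have m: "0 < m" using nn by (simp add: m_def)
  define B where "B = {g \<in> carrier G. len g \<le> m + 4 * R + 2 * \<Delta>}"
  have finB: "finite (B \<times> B)" unfolding B_def using finite_ball by simp
  define N where "N = Suc (card (B \<times> B))"
  obtain g where g: "g \<in> carrier G" "real (Suc N) * m < len g"
    using exists_long[OF inf order_refl] by blast
  have "\<forall>t\<in>{0..len g}. \<exists>k. k \<in> carrier G \<and> len k \<le> t + R \<and> len (inv k \<otimes> g) \<le> len g - t + R"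
  proof
    fix t assume "t \<in> {0..len g}"
    then show "\<exists>k. k \<in> carrier G \<and> len k \<le> t + R \<and> len (inv k \<otimes> g) \<le> len g - t + R"
      using coarse_geodesic[OF g(1), of t] by auto
  qed
  from bchoice[OF this] obtain \<kappa> where "\<forall>t\<in>{0..len g}. \<kappa> t \<in> carrier G \<and> len (\<kappa> t) \<le> t + R \<and>
      len (inv \<kappa> t \<otimes> g) \<le> len g - t + R"
    by blast
  then have \<kappa>: "\<kappa> t \<in> carrier G \<and> len (\<kappa> t) \<le> t + R \<and> len (inv \<kappa> t \<otimes> g) \<le> len g - t + R"
    if "t \<in> {0..len g}" for t using that by blast
  define D where "D s t = len (inv \<kappa> s \<otimes> \<kappa> t)" for s t
  \<comment> \<open>The points \<kappa> s and \<kappa> t are chosen independently of each other.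
    That they are not far apart follows from the four-point inequality, as both lie near the way to
    \<open>g\<close>.\<close>
  have dist: "t - s - 2 * R \<le> D s t" "D s t \<le> t - s + 4 * R + 2 * \<Delta>" "D t s = D s t"
    if st: "0 \<le> s" "s \<le> t" "t \<le> len g" for s t
  proof -
    have s: "\<kappa> s \<in> carrier G" "len (\<kappa> s) \<le> s + R" "len (inv \<kappa> s \<otimes> g) \<le> len g - s + R"
      and t: "\<kappa> t \<in> carrier G" "len (\<kappa> t) \<le> t + R" "len (inv \<kappa> t \<otimes> g) \<le> len g - t + R"
      using \<kappa>[of s] \<kappa>[of t] st by auto
    have low: "len g \<le> len (\<kappa> t) + len (inv \<kappa> t \<otimes> g)" "len (\<kappa> t) \<le> len (\<kappa> s) + D s t"
      "len g \<le> len (\<kappa> s) + len (inv \<kappa> s \<otimes> g)"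
      using len_mult[of "\<kappa> t" "inv \<kappa> t \<otimes> g"] len_mult[of "\<kappa> s" "inv \<kappa> s \<otimes> \<kappa> t"]
        len_mult[of "\<kappa> s" "inv \<kappa> s \<otimes> g"] s t g by (simp_all add: D_def)
    then show "t - s - 2 * R \<le> D s t" using s t by simp
    have "gp (\<kappa> s) g - \<Delta> \<le> gp (\<kappa> s) (\<kappa> t) \<or> gp g (\<kappa> t) - \<Delta> \<le> gp (\<kappa> s) (\<kappa> t)"
      using s t g by (intro four_point) auto
    moreover have "gp g (\<kappa> t) = gp (\<kappa> t) g" using g t by (simp add: gp_commute)
    ultimately have "s - R - \<Delta> \<le> gp (\<kappa> s) (\<kappa> t)"
      using len_inv_mult_eq[of "\<kappa> s" g] len_inv_mult_eq[of "\<kappa> t" g] s t g low st by auto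
    then show "D s t \<le> t - s + 4 * R + 2 * \<Delta>"
      using len_inv_mult_eq[of "\<kappa> s" "\<kappa> t"] s t by (simp add: D_def)
    show "D t s = D s t" using s t len_inv_mult_commute by (simp add: D_def)
  qed
  define f where "f i = (inv \<kappa> (real i * m) \<otimes> \<kappa> ((real i - 1) * m), inv \<kappa> (real i * m) \<otimes> \<kappa> ((real i + 1) * m))"
    for i :: nat
  have range: "0 \<le> (real i - 1) * m" "(real i - 1) * m \<le> real i * m" "real i * m \<le> (real i + 1) * m"
    "(real i + 1) * m \<le> len g" if "i \<in> {1..N}" for i
  proof -
    have "(real i + 1) * m \<le> real (Suc N) * m"
      using that m by (intro mult_right_mono) auto
    then show "(real i + 1) * m \<le> len g" using g by simp
  qed (use that m in \<open>auto simp: mult_le_cancel_right\<close>)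
  have "f i \<in> B \<times> B" if "i \<in> {1..N}" for i
  proof -
    note r = range[OF that]
    have "D (real i * m) ((real i - 1) * m) \<le> m + 4 * R + 2 * \<Delta>"
      using dist(2,3)[of "(real i - 1) * m" "real i * m"] r by (simp add: algebra_simps)
    moreover have "D (real i * m) ((real i + 1) * m) \<le> m + 4 * R + 2 * \<Delta>"
      using dist(2)[of "real i * m" "(real i + 1) * m"] r by (simp add: algebra_simps)
    moreover have "\<kappa> ((real i - 1) * m) \<in> carrier G" "\<kappa> (real i * m) \<in> carrier G" "\<kappa> ((real i + 1) * m) \<in> carrier G"
      using \<kappa> r by auto
    ultimately show ?thesis by (simp add: f_def B_def D_def)
  qed
  then have "f ` {1..N} \<subseteq> B \<times> B" by blast
  then have "card (f ` {1..N}) \<le> card (B \<times> B)" using finB card_mono by blast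
  then have "\<not> inj_on f {1..N}" using card_image[of f "{1..N}"] by (auto simp: N_def)
  then obtain i j where "i \<in> {1..N}" "j \<in> {1..N}" "i < j" "f i = f j"
    unfolding inj_on_def by (metis nat_neq_iff)
  note ij = this
  define s where "s = real i * m"
  define t where "t = real j * m"
  have shift: "(real i - 1) * m = s - m" "(real i + 1) * m = s + m" "(real j - 1) * m = t - m" "(real j + 1) * m = t + m"
    by (auto simp: s_def t_def algebra_simps)
  have "(real i + 1) * m \<le> real j * m" using ij m by (intro mult_right_mono) auto
  then have st: "s + m \<le> t" using shift by (simp add: t_def)
  have rs: "0 \<le> s - m" "t + m \<le> len g" using range[OF ij(1)] range[OF ij(2)] shift by auto
  have cl: "\<kappa> (s - m) \<in> carrier G" "\<kappa> s \<in> carrier G" "\<kappa> (s + m) \<in> carrier G" "\<kappa> (t - m) \<in> carrier G" "\<kappa> t \<in> carrier G"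
    using \<kappa> rs st m by auto
  define p where "p = inv \<kappa> s \<otimes> \<kappa> (s - m)"
  define q where "q = inv \<kappa> s \<otimes> \<kappa> (s + m)"
  define h where "h = inv \<kappa> s \<otimes> \<kappa> t"
  \<comment> \<open>The shared picture makes \<open>p\<close> the backward direction at \<kappa> t
    as well as at \<kappa> s.\<close>
  have p': "p = inv \<kappa> t \<otimes> \<kappa> (t - m)"
    using ij(4) shift by (simp add: f_def p_def flip: s_def t_def)
  have invh: "inv h = inv \<kappa> t \<otimes> \<kappa> s" using cl by (simp add: h_def inv_mult_group)
  have hpq: "h \<in> carrier G" "p \<in> carrier G" "q \<in> carrier G" using cl by (auto simp: h_def p_def q_def)
  have 1: "2 * gp h q = D s t + D s (s + m) - D t (s + m)"
    using gp_based[of "\<kappa> s" "\<kappa> t" "\<kappa> (s + m)"] cl by (simp add: h_def q_def D_def)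
  have 2: "2 * gp (inv h) p = D t s + D t (t - m) - D s (t - m)"
    using gp_based[of "\<kappa> t" "\<kappa> s" "\<kappa> (t - m)"] cl by (simp add: invh p' D_def)
  have 3: "2 * gp p q = D s (s - m) + D s (s + m) - D (s - m) (s + m)"
    using gp_based[of "\<kappa> s" "\<kappa> (s - m)" "\<kappa> (s + m)"] cl by (simp add: p_def q_def D_def)
  have hq: "m - 4 * R - \<Delta> \<le> gp h q"
    using 1 dist(1)[of s t] dist(1)[of s "s + m"] dist(2,3)[of "s + m" t] st rs m by simp
  have hp: "m - 4 * R - \<Delta> \<le> gp (inv h) p"
    using 2 dist(1,3)[of s t] dist(1,3)[of "t - m" t] dist(2,3)[of s "t - m"] st rs m by simp
  have pq: "gp p q \<le> 5 * R + 2 * \<Delta>"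
    using 3 dist(2,3)[of "s - m" s] dist(2)[of s "s + m"] dist(1)[of "s - m" "s + m"] st rs m by simp
  \<comment> \<open>\<open>inv h\<close> follows \<open>p\<close>, which diverges from
    \<open>q\<close>, so \<open>inv h\<close> diverges from \<open>q\<close>; and \<open>h\<close>
    follows \<open>q\<close>, so \<open>inv h\<close> diverges from \<open>h\<close>.\<close>
  have "gp p (inv h) - \<Delta> \<le> gp p q \<or> gp (inv h) q - \<Delta> \<le> gp p q"
    using hpq by (intro four_point) auto
  moreover have "gp (inv h) h - \<Delta> \<le> gp (inv h) q \<or> gp h q - \<Delta> \<le> gp (inv h) q"
    using hpq by (intro four_point) auto
  moreover have "gp p (inv h) = gp (inv h) p" using hpq by (simp add: gp_commute)
  ultimately have "gp (inv h) h \<le> 5 * R + 4 * \<Delta>" using hq hp pq nn by (auto simp: m_def)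
  moreover have "m - 2 * R \<le> len h"
    using dist(1)[of s t] rs st m by (simp add: D_def h_def)
  ultimately have "loxodromic (5 * R + 4 * \<Delta>) h"
    using hpq nn by (auto simp: loxodromic_def m_def)
  then show thesis by (rule that)
qed

lemma gp_int_power_opposite:
  assumes lox: "loxodromic c h"
  shows "gp (h [^] (- i)) (h [^] (i::int)) \<le> c + 2 * \<Delta>"
proof -
  note l = loxodromicD[OF lox]
  have nat: "gp (h [^] (- int n)) (h [^] (int n)) \<le> c + 2 * \<Delta>" for n :: nat
    using gp_power_power[OF l(1,3,4), of n n] l by (simp add: int_pow_neg int_pow_int nat_pow_inv)
  show ?thesis
  proof (cases i rule: int_cases2)
    case (nonneg n)
    then show ?thesis using nat by simp
  next
    case (nonpos n)
    then show ?thesis using nat[of n] l by (simp add: gp_commute)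
  qed
qed

section \<open>Independence: translates of the axis of a loxodromic element\<close>

text \<open>If the axis of \<open>h\<close> and its translate by \<open>x\<close> run together for
  arbitrarily long, infinitely many powers h^i lie within a fixed distance of some x h^j. By
  finiteness of balls two of these have the same difference h^(-i) x h^j, and eliminating it gives
  the relation.\<close>

lemma commensurating_if_unbounded:
  assumes lox: "loxodromic c h" and x: "x \<in> carrier G"
    and unbounded: "\<And>B. \<exists>(i::int) (j::int). B < gp (h [^] i) (x \<otimes> h [^] j)"
  obtains p q :: int where "p \<noteq> 0" "q \<noteq> 0" "x \<otimes> h [^] p = h [^] q \<otimes> x"
proof -
  note l = loxodromicD[OF lox]
  define e where "e = c + 2 * \<Delta>"
  define E where "E = 2 * len h + 3 * len x + 2 * e + 4 * \<Delta>"
  define I where "I = {i :: int. \<exists>j :: int. len (inv (h [^] i) \<otimes> (x \<otimes> h [^] j)) \<le> E}"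
  have far: "\<exists>i\<in>I. n \<le> len (h [^] i)" for n
  proof -
    obtain i j :: int where ij: "max n 0 + len x < gp (h [^] i) (x \<otimes> h [^] j)"
      using unbounded[of "max n 0 + len x"] by auto
    \<comment> \<open>Subtracting \<open>len x\<close> makes \<open>t\<close> at most the length of
      both \<open>h [^] i\<close> and \<open>h [^] j\<close>, so both axes have powers at distance
      about \<open>t\<close>.\<close>
    define t where "t = gp (h [^] i) (x \<otimes> h [^] j) - len x"
    have t: "0 \<le> t" "n \<le> t" using ij by (auto simp: t_def)
    have "t \<le> len (h [^] i)" "t \<le> len (h [^] j)"
      using gp_bounds(2,3)[of "h [^] i" "x \<otimes> h [^] j"] len_mult[of x "h [^] j"] l x len_nonneg[of x]
      by (auto simp: t_def)
    then obtain i' j' :: int where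
      i': "t \<le> len (h [^] i')" "len (h [^] i') \<le> t + len h" "len (h [^] i') - c - 2 * \<Delta> \<le> gp (h [^] i') (h [^] i)" and
      j': "t \<le> len (h [^] j')" "len (h [^] j') \<le> t + len h" "len (h [^] j') - c - 2 * \<Delta> \<le> gp (h [^] j') (h [^] j)"
      using int_power_on_axis[OF lox t(1)] by metis
    have "gp (h [^] j) (h [^] j') - len x \<le> gp (x \<otimes> h [^] j) (x \<otimes> h [^] j')"
      using l x by (intro gp_translate) auto
    moreover have "gp (h [^] j) (h [^] j') = gp (h [^] j') (h [^] j)" using l by (simp add: gp_commute)
    moreover have "gp (h [^] i') (h [^] i) - \<Delta> \<le> gp (h [^] i') (x \<otimes> h [^] j) \<or>
        gp (h [^] i) (x \<otimes> h [^] j) - \<Delta> \<le> gp (h [^] i') (x \<otimes> h [^] j)"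
      using l x by (intro four_point) auto
    moreover have "gp (h [^] i') (x \<otimes> h [^] j) - \<Delta> \<le> gp (h [^] i') (x \<otimes> h [^] j') \<or>
        gp (x \<otimes> h [^] j) (x \<otimes> h [^] j') - \<Delta> \<le> gp (h [^] i') (x \<otimes> h [^] j')"
      using l x by (intro four_point) auto
    ultimately have "t - e - len x - 2 * \<Delta> \<le> gp (h [^] i') (x \<otimes> h [^] j')"
      using i' j' l x len_nonneg[of x] \<Delta>_nonneg by (auto simp: e_def t_def)
    moreover have "len (inv (h [^] i') \<otimes> (x \<otimes> h [^] j')) =
        len (h [^] i') + len (x \<otimes> h [^] j') - 2 * gp (h [^] i') (x \<otimes> h [^] j')"
      using l x by (intro len_inv_mult_eq) auto
    ultimately have "len (inv (h [^] i') \<otimes> (x \<otimes> h [^] j')) \<le> E"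
      using i' j' len_mult[of x "h [^] j'"] l x by (simp add: E_def)
    then show ?thesis using i' t unfolding I_def by force
  qed
  have infI: "infinite I"
  proof
    assume fin: "finite I"
    obtain i where i: "i \<in> I" "Max ((\<lambda>i. len (h [^] i)) ` I) + 1 \<le> len (h [^] i)" using far by blast
    then have "len (h [^] i) \<le> Max ((\<lambda>i. len (h [^] i)) ` I)" using fin by auto
    then show False using i by simp
  qed
  define J :: "int \<Rightarrow> int" where "J i = (SOME j. len (inv (h [^] i) \<otimes> (x \<otimes> h [^] j)) \<le> E)" for i
  have J: "len (inv (h [^] i) \<otimes> (x \<otimes> h [^] J i)) \<le> E" if "i \<in> I" for i
    using that unfolding I_def J_def by (auto intro: someI_ex)
  define y where "y i = inv (h [^] i) \<otimes> (x \<otimes> h [^] J i)" for i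
  have "y ` I \<subseteq> {g \<in> carrier G. len g \<le> E}" using J l x by (auto simp: y_def)
  then have "finite (y ` I)" using finite_ball finite_subset by blast
  then have "\<not> inj_on y I" using infI finite_imageD by blast
  then obtain i k where ik: "i \<in> I" "k \<in> I" "i \<noteq> k" "y i = y k" unfolding inj_on_def by blast
  have yeq: "x \<otimes> h [^] J i = h [^] i \<otimes> y k"
    using l x by (simp flip: ik(4)) (simp add: y_def)
  have "x \<otimes> h [^] (J i - J k) = (x \<otimes> h [^] J i) \<otimes> h [^] (- J k)"
    using l x int_pow_mult[of h "J i" "- J k"] by (simp add: m_assoc)
  also have "\<dots> = h [^] i \<otimes> (inv (h [^] k) \<otimes> (x \<otimes> (h [^] J k \<otimes> h [^] (- J k))))"
    unfolding yeq using l x by (simp add: m_assoc y_def del: inv_mult_cancel)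
  also have "\<dots> = h [^] (i - k) \<otimes> x"
    using l x by (simp add: m_assoc int_pow_mult int_pow_diff int_pow_neg)
  finally have eq: "x \<otimes> h [^] (J i - J k) = h [^] (i - k) \<otimes> x" .
  have J_neq: "J i - J k \<noteq> 0"
  proof
    assume "J i - J k = 0"
    then have "h [^] (i - k) \<otimes> x = \<one> \<otimes> x" using eq x by simp
    then have "h [^] (i - k) = \<one>" using l x by (simp del: l_one)
    then show False using len_int_power_ge[OF lox, of "i - k"] ik by simp
  qed
  show thesis by (rule that[OF J_neq _ eq]) (use ik in simp)
qed

text \<open>The point is that the bound depends on neither \<open>x\<close> nor the exponents. By
  the relation, h^(-n) and h^n seen from x are h^(-i) and h^i up to a right factor
  \<open>inv x\<close>, and these diverge at once. Hence x lies near the segment from h^(-n) to h^n,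
  and so near a power of \<open>h\<close>.\<close>

lemma commensurating_near_axis:
  assumes lox: "loxodromic c h" and x: "x \<in> carrier G"
    and pq: "p \<noteq> 0" "q \<noteq> 0" "x \<otimes> h [^] (p::int) = h [^] (q::int) \<otimes> x"
  obtains j :: int where "len (inv (h [^] j) \<otimes> x) \<le> len h + 6 * c + 30 * \<Delta>"
proof -
  note l = loxodromicD[OF lox]
  define e where "e = c + 2 * \<Delta>"
  define e' where "e' = e + 2 * \<Delta>"
  \<comment> \<open>The exponents are scaled up until h^i is so long that the right factor
    \<open>inv x\<close> cannot change its direction.\<close>
  define k where "k = nat \<lceil>len x + e' + 1\<rceil>"
  have k: "len x + e' + 1 \<le> real k" unfolding k_def by (rule real_nat_ceiling_ge)
  have comm: "x \<otimes> h [^] (p * int k) = h [^] (q * int k) \<otimes> x" for k :: nat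
  proof (induction k)
    case (Suc k)
    have Suc_eq: "h [^] (i * int (Suc k)) = h [^] (i * int k) \<otimes> h [^] i" for i
      using int_pow_mult[of h "i * int k" i] l by (simp add: algebra_simps)
    have "x \<otimes> h [^] (p * int (Suc k)) = x \<otimes> h [^] (p * int k) \<otimes> h [^] p"
      using l x by (simp only: m_assoc Suc_eq int_pow_closed)
    also have "\<dots> = h [^] (q * int k) \<otimes> (h [^] q \<otimes> x)"
      unfolding Suc using l x pq by (simp add: m_assoc)
    also have "\<dots> = h [^] (q * int (Suc k)) \<otimes> x"
      using l x by (simp only: Suc_eq m_assoc int_pow_closed)
    finally show ?case .
  qed (use l x in simp)
  define i where "i = p * int k"
  define n where "n = q * int k"
  have len_i: "real k \<le> len (h [^] i)"
  proof -
    have "1 * int k \<le> \<bar>p\<bar> * int k" using pq by (intro mult_right_mono) auto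
    then have "int k \<le> \<bar>i\<bar>" by (simp add: i_def abs_mult)
    then show ?thesis using len_int_power_ge[OF lox, of i] by linarith
  qed
  have pos: "inv x \<otimes> h [^] n = h [^] i \<otimes> inv x"
  proof -
    have "h [^] n = x \<otimes> h [^] i \<otimes> inv x"
      using comm[of k] l x by (simp add: i_def n_def m_assoc)
    then show ?thesis using l x by (simp add: m_assoc)
  qed
  have neg: "inv x \<otimes> h [^] (- n) = h [^] (- i) \<otimes> inv x"
  proof -
    have "inv (inv x \<otimes> h [^] n) = inv (h [^] i \<otimes> inv x)" using pos by simp
    then have "h [^] (- n) \<otimes> x = x \<otimes> h [^] (- i)"
      using l x by (simp add: inv_mult_group int_pow_neg)
    then have "h [^] (- n) = x \<otimes> h [^] (- i) \<otimes> inv x"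
      using l x by (metis int_pow_closed inv_closed inv_solve_right m_closed)
    then show ?thesis using l x by (simp add: m_assoc)
  qed
  have near: "len (h [^] i) - len x \<le> gp (h [^] i') (h [^] i' \<otimes> inv x)" if "i' = i \<or> i' = - i" for i'
  proof -
    have "len (h [^] i') = len (h [^] i)" using that l by (auto simp: int_pow_neg)
    then show ?thesis
      using gp_mult_self[of "h [^] i'" "inv x"] gp_bounds(3)[of "inv (h [^] i')" "inv x"] l x by simp
  qed
  have a: "gp (h [^] (- i)) (h [^] i) \<le> e" using gp_int_power_opposite[OF lox] by (simp add: e_def)
  have "gp (h [^] (- i)) (h [^] (- i) \<otimes> inv x) - \<Delta> \<le> gp (h [^] (- i)) (h [^] i) \<or>
      gp (h [^] (- i) \<otimes> inv x) (h [^] i) - \<Delta> \<le> gp (h [^] (- i)) (h [^] i)"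
    using l x by (intro four_point) auto
  moreover have "gp (h [^] (- i) \<otimes> inv x) (h [^] i \<otimes> inv x) - \<Delta> \<le> gp (h [^] (- i) \<otimes> inv x) (h [^] i) \<or>
      gp (h [^] i \<otimes> inv x) (h [^] i) - \<Delta> \<le> gp (h [^] (- i) \<otimes> inv x) (h [^] i)"
    using l x by (intro four_point) auto
  moreover have "gp (h [^] i \<otimes> inv x) (h [^] i) = gp (h [^] i) (h [^] i \<otimes> inv x)"
    using l x by (simp add: gp_commute)
  ultimately have "gp (inv x \<otimes> h [^] (- n)) (inv x \<otimes> h [^] n) \<le> e'"
    using near[of i] near[of "- i"] a len_i k \<Delta>_nonneg len_nonneg[of x] x unfolding pos neg
    by (auto simp: e'_def)
  moreover have "2 * gp (inv x \<otimes> h [^] (- n)) (inv x \<otimes> h [^] n) =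
      len (inv x \<otimes> h [^] (- n)) + len (inv x \<otimes> h [^] n) - len (inv (h [^] (- n)) \<otimes> h [^] n)"
    using l x by (intro gp_based) auto
  moreover have "inv (h [^] (- n)) \<otimes> h [^] n = h [^] (2 * n)"
    using l int_pow_mult[of h n n] by (simp add: int_pow_neg)
  \<comment> \<open>Translating by h^n makes the segment start at 1, where
    \<open>int_power_on_axis\<close> applies; the shift is undone at the end by the exponent
    \<open>j - n\<close>.\<close>
  moreover define y where "y = h [^] n \<otimes> x"
  moreover have "len (inv x \<otimes> h [^] (- n)) = len y"
    using l x len_inv[of y] by (simp add: y_def inv_mult_group int_pow_neg)
  moreover have "inv y \<otimes> h [^] (2 * n) = inv x \<otimes> h [^] n"
  proof -
    have "h [^] (2 * n) = h [^] n \<otimes> h [^] n" using l int_pow_mult[of h n n] by simp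
    then show ?thesis using l x by (simp add: y_def inv_mult_group m_assoc)
  qed
  ultimately have tri: "len y + len (inv y \<otimes> h [^] (2 * n)) - len (h [^] (2 * n)) \<le> 2 * e'"
    by simp
  have y: "y \<in> carrier G" using l x by (simp add: y_def)
  have gpy: "len y - e' \<le> gp y (h [^] (2 * n))"
    using len_inv_mult_eq[of y "h [^] (2 * n)"] y l tri by simp
  define t where "t = min (len y) (len (h [^] (2 * n)))"
  have "0 \<le> t" "t \<le> len (h [^] (2 * n))" using len_nonneg y l by (auto simp: t_def)
  then obtain j :: int where j: "t \<le> len (h [^] j)" "len (h [^] j) \<le> t + len h"
    "len (h [^] j) - c - 2 * \<Delta> \<le> gp (h [^] j) (h [^] (2 * n))"
    using int_power_on_axis[OF lox] by metis
  \<comment> \<open>\<open>y\<close> is almost on the segment, so truncating its length at the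
    length of the segment loses at most 2 e'.\<close>
  have t: "len y - 2 * e' \<le> t" "t \<le> len y"
    using tri len_nonneg[of "inv y \<otimes> h [^] (2 * n)"] y l \<Delta>_nonneg by (auto simp: t_def e'_def e_def)
  have "gp (h [^] j) (h [^] (2 * n)) - \<Delta> \<le> gp (h [^] j) y \<or> gp (h [^] (2 * n)) y - \<Delta> \<le> gp (h [^] j) y"
    using l y by (intro four_point) auto
  moreover have "gp (h [^] (2 * n)) y = gp y (h [^] (2 * n))" using l y by (simp add: gp_commute)
  ultimately have "len y - 2 * e' - e - \<Delta> \<le> gp (h [^] j) y"
    using j gpy t l \<Delta>_nonneg by (auto simp: e_def e'_def)
  moreover have "len (inv (h [^] j) \<otimes> y) = len (h [^] j) + len y - 2 * gp (h [^] j) y"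
    using l y by (intro len_inv_mult_eq) auto
  ultimately have "len (inv (h [^] j) \<otimes> y) \<le> len h + 6 * c + 30 * \<Delta>"
    using j t \<Delta>_nonneg by (simp add: e_def e'_def)
  moreover have "inv (h [^] (j - n)) = inv (h [^] j) \<otimes> h [^] n"
    using l int_pow_mult[of h "- j" n] int_pow_neg[of h "j - n"] by (simp add: int_pow_neg)
  then have "inv (h [^] j) \<otimes> y = inv (h [^] (j - n)) \<otimes> x"
    using l x by (simp add: y_def m_assoc)
  ultimately show thesis using that[of "j - n"] by simp
qed

lemma virtually_cyclic_if_cobounded:
  assumes h: "h \<in> carrier G"
    and near: "\<And>g. g \<in> carrier G \<Longrightarrow> \<exists>j::int. len (inv (h [^] j) \<otimes> g) \<le> E"
  shows "virtually_cyclic G"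
proof -
  let ?H = "generate G {h}"
  have H: "subgroup ?H G" using h by (intro generate_is_subgroup) auto
  have "rcosets ?H \<subseteq> (\<lambda>x. ?H #> x) ` {x \<in> carrier G. len x \<le> E}"
  proof
    fix c assume "c \<in> rcosets ?H"
    then obtain g where g: "g \<in> carrier G" "c = ?H #> g" by (auto simp: RCOSETS_def)
    obtain j :: int where j: "len (inv (h [^] j) \<otimes> g) \<le> E" using near g by blast
    define x where "x = inv (h [^] j) \<otimes> g"
    have x: "x \<in> carrier G" using h g by (simp add: x_def)
    have "g = h [^] j \<otimes> x" using h g by (simp add: x_def)
    moreover have "h [^] j \<in> ?H" using generate_pow[OF h] by blast
    ultimately have "g \<in> ?H #> x" by (auto simp: r_coset_def)
    then have "?H #> x = ?H #> g" using repr_independence H x by blast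
    then show "c \<in> (\<lambda>x. ?H #> x) ` {x \<in> carrier G. len x \<le> E}" using g x j by (auto simp: x_def)
  qed
  then have "finite (rcosets ?H)" using finite_ball finite_surj by blast
  then show ?thesis using h by (auto simp: virtually_cyclic_def)
qed

lemma infinite_if_not_virtually_cyclic:
  assumes "\<not> virtually_cyclic G"
  shows "infinite (carrier G)"
  using assms by (auto simp: virtually_cyclic_def RCOSETS_def)

text \<open>As the group is not virtually cyclic, some \<open>x\<close> lies further from all powers
  of \<open>h\<close> than any commensurating element can, so the axis of \<open>h\<close> and its
  translate by \<open>x\<close> run together only for a bounded time, in all directions.\<close>

lemma exists_independent:
  assumes nvc: "\<not> virtually_cyclic G"
  obtains c h x B where "loxodromic c h" "x \<in> carrier G"
    "\<And>(i::int) (j::int). gp (h [^] i) (x \<otimes> h [^] j) \<le> B"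
proof -
  obtain h where h: "loxodromic (5 * R + 4 * \<Delta>) h"
    using exists_loxodromic[OF infinite_if_not_virtually_cyclic[OF nvc]] by blast
  let ?c = "5 * R + 4 * \<Delta>"
  obtain x where x: "x \<in> carrier G" "\<nexists>j::int. len (inv (h [^] j) \<otimes> x) \<le> len h + 6 * ?c + 30 * \<Delta>"
    using virtually_cyclic_if_cobounded[OF loxodromicD(1)[OF h]] nvc by blast
  have ex: "\<exists>B. \<forall>(i::int) (j::int). gp (h [^] i) (x \<otimes> h [^] j) \<le> B"
  proof (rule ccontr)
    assume "\<not> ?thesis"
    then have "\<exists>(i::int) (j::int). B < gp (h [^] i) (x \<otimes> h [^] j)" for B by (simp add: not_le)
    then obtain p q :: int where "p \<noteq> 0" "q \<noteq> 0" "x \<otimes> h [^] p = h [^] q \<otimes> x"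
      by (rule commensurating_if_unbounded[OF h x(1)])
    then obtain j :: int where "len (inv (h [^] j) \<otimes> x) \<le> len h + 6 * ?c + 30 * \<Delta>"
      by (rule commensurating_near_axis[OF h x(1)])
    then show False using x(2) by blast
  qed
  then obtain B where "\<forall>(i::int) (j::int). gp (h [^] i) (x \<otimes> h [^] j) \<le> B" by (rule exE)
  then have "\<And>(i::int) (j::int). gp (h [^] i) (x \<otimes> h [^] j) \<le> B" by simp
  then show thesis by (rule that[OF h x(1)])
qed

section \<open>Joining elements without cancellation\<close>

text \<open>\<open>U\<close> consists of high powers of \<open>h\<close> and of its conjugate by
  \<open>x\<close>, together with their inverses: four pairwise diverging directions.
  \<open>inv g\<close> can follow only one of them and \<open>k\<close> only one of their inverses,
  so at least two elements of \<open>U\<close> remain. Raising the power changes \<open>K\<close>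
  but not \<open>C\<close>.\<close>

lemma exists_extension_set:
  assumes nvc: "\<not> virtually_cyclic G"
  obtains C where "0 \<le> C"
    "\<And>K. \<exists>U. finite U \<and> U \<subseteq> carrier G \<and> (\<forall>u\<in>U. K \<le> len u) \<and>
       (\<forall>u\<in>U. \<forall>v\<in>U. u \<noteq> v \<longrightarrow> gp u v \<le> C) \<and> (\<exists>u\<in>U. \<exists>v\<in>U. u \<noteq> v) \<and>
       (\<forall>g\<in>carrier G. \<forall>k\<in>carrier G. \<exists>u\<in>U. gp (inv g) u \<le> C \<and> gp (inv u) k \<le> C)"
proof -
  obtain c h x B where lox: "loxodromic c h" and x: "x \<in> carrier G"
    and B: "\<And>(i::int) (j::int). gp (h [^] i) (x \<otimes> h [^] j) \<le> B"
    using exists_independent[OF nvc] by metis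
  note l = loxodromicD[OF lox]
  \<comment> \<open>Three times \<open>len x\<close>: comparing the two conjugates with
    \<open>p\<close> and \<open>q\<close> takes two right factors \<open>inv x\<close> and one
    translation by \<open>x\<close>.\<close>
  define C0 where "C0 = max B (c + 2 * \<Delta>) + 3 * len x"
  define C where "C = C0 + \<Delta>"
  have C0: "B + len x \<le> C0" "c + 2 * \<Delta> + 3 * len x \<le> C0" "c + 2 * \<Delta> \<le> C0" "0 \<le> C0"
    using len_nonneg[OF x] \<Delta>_nonneg l(2) by (auto simp: C0_def)
  have ex: "\<exists>U. finite U \<and> U \<subseteq> carrier G \<and> (\<forall>u\<in>U. K \<le> len u) \<and>
       (\<forall>u\<in>U. \<forall>v\<in>U. u \<noteq> v \<longrightarrow> gp u v \<le> C) \<and> (\<exists>u\<in>U. \<exists>v\<in>U. u \<noteq> v) \<and>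
       (\<forall>g\<in>carrier G. \<forall>k\<in>carrier G. \<exists>u\<in>U. gp (inv g) u \<le> C \<and> gp (inv u) k \<le> C)" for K
  proof -
    \<comment> \<open>Conjugation shortens by at most \<open>2 * len x\<close>. Length beyond
      \<open>C0\<close> makes \<open>p\<close> and \<open>q\<close> different, since otherwise
      \<open>gp p q\<close> would be \<open>len p\<close>.\<close>
    define n where "n = nat \<lceil>max K (C0 + 1) + 2 * len x\<rceil>"
    have n: "max K (C0 + 1) + 2 * len x \<le> real n" unfolding n_def by (rule real_nat_ceiling_ge)
    define p where "p = h [^] int n"
    define q where "q = h [^] (- int n)"
    define p' where "p' = x \<otimes> p \<otimes> inv x"
    define q' where "q' = x \<otimes> q \<otimes> inv x"
    have cl: "p \<in> carrier G" "q \<in> carrier G" "p' \<in> carrier G" "q' \<in> carrier G"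
      using l x by (auto simp: p_def q_def p'_def q'_def)
    have inv: "inv p = q" "inv q = p" "inv p' = q'" "inv q' = p'"
      using l x by (simp_all add: p_def q_def p'_def q'_def int_pow_neg inv_mult_group m_assoc)
    have lenpq: "real n \<le> len p" "real n \<le> len q"
      using len_int_power_ge[OF lox, of "int n"] len_int_power_ge[OF lox, of "- int n"]
      by (simp_all add: p_def q_def)
    have conj: "len z \<le> len (x \<otimes> z \<otimes> inv x) + 2 * len x" if z: "z \<in> carrier G" for z
    proof -
      have "z = inv x \<otimes> ((x \<otimes> z \<otimes> inv x) \<otimes> x)" using z x by (simp add: m_assoc)
      then show ?thesis
        using len_mult[of "inv x" "(x \<otimes> z \<otimes> inv x) \<otimes> x"] len_mult[of "x \<otimes> z \<otimes> inv x" x] z x by simp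
    qed
    have long: "max K (C0 + 1) \<le> len u" if "u \<in> {p, q, p', q'}" for u
      using that lenpq conj[of p] conj[of q] cl n len_nonneg[OF x] by (auto simp: p'_def q'_def)
    have mixed: "gp y (x \<otimes> z \<otimes> inv x) \<le> C0" if "y \<in> {p, q}" "z \<in> {p, q}" for y z
    proof -
      have "gp y (x \<otimes> z) \<le> B" using that B by (auto simp: p_def q_def)
      moreover have "gp y (x \<otimes> z \<otimes> inv x) \<le> gp y (x \<otimes> z) + len (inv x)"
        using that cl x by (intro gp_mult_right) auto
      ultimately show ?thesis using C0 x by simp
    qed
    have pq: "gp p q \<le> c + 2 * \<Delta>"
      using gp_int_power_opposite[OF lox, of "- int n"] by (simp add: p_def q_def)
    have p'q': "gp p' q' \<le> C0"
    proof -
      have "gp p' q' \<le> gp p' (x \<otimes> q) + len x"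
        using gp_mult_right[of "inv x" p' "x \<otimes> q"] cl x by (simp add: q'_def)
      moreover have "gp (x \<otimes> q) p' \<le> gp (x \<otimes> q) (x \<otimes> p) + len x"
        using gp_mult_right[of "inv x" "x \<otimes> q" "x \<otimes> p"] cl x by (simp add: p'_def)
      moreover have "gp (x \<otimes> p) (x \<otimes> q) \<le> gp p q + len x"
        using cl x by (intro gp_translate) auto
      moreover have "gp p' (x \<otimes> q) = gp (x \<otimes> q) p'" "gp (x \<otimes> q) (x \<otimes> p) = gp (x \<otimes> p) (x \<otimes> q)"
        using cl x by (auto intro: gp_commute)
      ultimately show ?thesis using pq C0 by simp
    qed
    have pair: "gp p q \<le> C0" "gp p p' \<le> C0" "gp p q' \<le> C0" "gp q p' \<le> C0" "gp q q' \<le> C0" "gp p' q' \<le> C0"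
      using pq C0 mixed p'q' by (auto simp: p'_def q'_def)
    have good: "gp g u \<le> C \<or> gp g v \<le> C"
      if "g \<in> carrier G" "u \<in> carrier G" "v \<in> carrier G" "gp u v \<le> C0" for g u v
      using four_point[of u g v] that gp_commute[of u g] by (auto simp: C_def)
    let ?U = "{p, q, p', q'}"
    have "\<exists>u\<in>?U. gp (inv g) u \<le> C \<and> gp (inv u) k \<le> C" if gk: "g \<in> carrier G" "k \<in> carrier G" for g k
    proof -
      have g: "gp (inv g) u \<le> C \<or> gp (inv g) v \<le> C"
        and k: "gp u k \<le> C \<or> gp v k \<le> C" if "u \<in> carrier G" "v \<in> carrier G" "gp u v \<le> C0" for u v
        using good[of "inv g" u v] good[of k u v] that gk gp_commute[of k u] gp_commute[of k v] by auto
      \<comment> \<open>What is left is propositional: of any two elements of \<open>U\<close> at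
        most one is bad for \<open>g\<close>, at most one for \<open>k\<close>, and \<open>U\<close>
        is closed under inverses.\<close>
      show ?thesis
        unfolding bex_simps inv
        using g[of p q] g[of p p'] g[of p q'] g[of q p'] g[of q q'] g[of p' q']
          k[of p q] k[of p p'] k[of p q'] k[of q p'] k[of q q'] k[of p' q'] cl pair by argo
    qed
    moreover have "\<forall>u\<in>?U. \<forall>v\<in>?U. u \<noteq> v \<longrightarrow> gp u v \<le> C"
      using pair cl \<Delta>_nonneg gp_commute by (auto simp: C_def intro: order_trans)
    moreover have "p \<noteq> q"
      using long[of p] pair(1) cl by auto
    ultimately show ?thesis
      using cl long by (intro exI[of _ ?U]) auto
  qed
  show thesis by (rule that[of C]) (use C0 \<Delta>_nonneg ex in \<open>auto simp: C_def\<close>)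
qed

section \<open>Poincare series and free semigroups\<close>

text \<open>Sorting elements by the integer part \<open>n\<close> of their length gives a geometric
  series with ratio \<open>exp (s' - s)\<close>. The factor \<open>exp s'\<close> arises because
  such elements are counted in the ball of radius n + 1.\<close>

lemma poincare_series_bound:
  assumes growth: "\<And>n::nat. real (card {g \<in> carrier G. len g \<le> real n}) \<le> Q * exp (s' * real n)"
    and s: "0 \<le> s" "s' < s"
  obtains Z where "\<And>B. finite B \<Longrightarrow> B \<subseteq> carrier G \<Longrightarrow> (\<Sum>g\<in>B. exp (- s * len g)) \<le> Z"
proof -
  define r where "r = exp (s' - s)"
  have r: "0 < r" "r < 1" using s by (auto simp: r_def)
  have "0 \<le> real (card {g \<in> carrier G. len g \<le> real 0})" by simp
  also have "\<dots> \<le> Q" using growth[of 0] by simp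
  finally have Q: "0 \<le> Q" .
  have "(\<Sum>g\<in>B. exp (- s * len g)) \<le> Q * exp s' * (1 / (1 - r))" if B: "finite B" "B \<subseteq> carrier G" for B
  proof -
    define f where "f g = nat \<lfloor>len g\<rfloor>" for g
    define N where "N = Suc (Max (f ` B))"
    have fl: "real (f g) \<le> len g" "len g \<le> real (Suc (f g))" if "g \<in> B" for g
      using len_nonneg[of g] B that unfolding f_def by (auto, linarith)
    have "f ` B \<subseteq> {..<N}" using B by (auto simp: N_def le_imp_less_Suc)
    then have "(\<Sum>g\<in>B. exp (- s * len g)) = (\<Sum>n<N. \<Sum>g\<in>{g \<in> B. f g = n}. exp (- s * len g))"
      using B by (intro sum.group[symmetric]) auto
    also have "\<dots> \<le> (\<Sum>n<N. Q * exp s' * r ^ n)"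
    proof (rule sum_mono)
      fix n
      let ?F = "{g \<in> B. f g = n}"
      have "(\<Sum>g\<in>?F. exp (- s * len g)) \<le> (\<Sum>g\<in>?F. exp (- s * real n))"
        using fl s by (intro sum_mono) (auto intro: mult_left_mono)
      also have "\<dots> = real (card ?F) * exp (- s * real n)" by simp
      also have "\<dots> \<le> real (card {g \<in> carrier G. len g \<le> real (Suc n)}) * exp (- s * real n)"
        using fl B finite_ball[of "real (Suc n)"]
        by (intro mult_right_mono of_nat_mono card_mono) auto
      also have "\<dots> \<le> Q * exp (s' * real (Suc n)) * exp (- s * real n)"
        using growth[of "Suc n"] by (rule mult_right_mono) simp
      also have "\<dots> = Q * exp s' * r ^ n"
        by (simp add: r_def algebra_simps flip: exp_add exp_of_nat_mult)
      finally show "(\<Sum>g\<in>?F. exp (- s * len g)) \<le> Q * exp s' * r ^ n" .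
    qed
    also have "\<dots> = Q * exp s' * (\<Sum>n<N. r ^ n)" by (simp add: sum_distrib_left)
    also have "(\<Sum>n<N. r ^ n) \<le> 1 / (1 - r)"
    proof -
      have "(\<Sum>n<N. r ^ n) = (1 - r ^ N) / (1 - r)" using r by (simp add: sum_gp_strict)
      then show ?thesis using r by (simp add: divide_right_mono)
    qed
    finally show ?thesis using Q by (simp add: mult_left_mono)
  qed
  then show thesis by (rule that)
qed

lemma exists_shortest:
  assumes "S \<subseteq> carrier G" "S \<noteq> {}"
  shows "\<exists>g. g \<in> S \<and> (\<forall>k\<in>S. len g \<le> len k)"
proof -
  obtain g0 where g0: "g0 \<in> S" using assms by blast
  define F where "F = {g \<in> S. len g \<le> len g0}"
  have "F \<subseteq> {g \<in> carrier G. len g \<le> len g0}" using assms by (auto simp: F_def)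
  then have F: "finite F" "F \<noteq> {}" using g0 finite_ball finite_subset by (auto simp: F_def)
  define g where "g = arg_min_on len F"
  have "g \<in> F" "\<And>k. k \<in> F \<Longrightarrow> len g \<le> len k"
    using arg_min_if_finite(1)[OF F] arg_min_least[OF F] by (auto simp: g_def)
  then show ?thesis by (intro exI[of _ g]) (force simp: F_def)
qed

definition shortest :: "'a set \<Rightarrow> 'a" where
  "shortest S = (SOME g. g \<in> S \<and> (\<forall>k\<in>S. len g \<le> len k))"

lemma shortest:
  assumes "S \<subseteq> carrier G" "S \<noteq> {}"
  shows "shortest S \<in> S" "k \<in> S \<Longrightarrow> len (shortest S) \<le> len k"
  using someI_ex[OF exists_shortest[OF assms]] by (auto simp: shortest_def)

text \<open>Greedy choice: keep one element and discard all others within \<open>r\<close> of it. At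
  most a ball's worth of elements goes, each weighing at most \<open>exp (\<sigma> * r)\<close>
  times the one kept. The fraction retained does not depend on \<open>F\<close>.\<close>

lemma weighted_net:
  assumes F: "finite F" "F \<subseteq> carrier G" and \<sigma>: "0 \<le> \<sigma>" and r: "0 \<le> r"
  shows "\<exists>A\<subseteq>F. (\<forall>a\<in>A. \<forall>a'\<in>A. a \<noteq> a' \<longrightarrow> r < len (inv a \<otimes> a')) \<and>
    (\<Sum>g\<in>F. exp (- \<sigma> * len g)) \<le>
      real (card {g \<in> carrier G. len g \<le> r}) * exp (\<sigma> * r) * (\<Sum>a\<in>A. exp (- \<sigma> * len a))"
  using F
proof (induction F rule: finite_psubset_induct)
  case (psubset F)
  let ?w = "\<lambda>g. exp (- \<sigma> * len g)"
  let ?c = "real (card {g \<in> carrier G. len g \<le> r}) * exp (\<sigma> * r)"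
  show ?case
  proof (cases "F = {}")
    case False
    then obtain x where x: "x \<in> F" by blast
    then have xG: "x \<in> carrier G" using psubset.prems by blast
    define N where "N = {g \<in> F. len (inv x \<otimes> g) \<le> r}"
    have "x \<in> N" using x xG r by (simp add: N_def)
    then have "F - N \<subset> F" using x by blast
    moreover have "F - N \<subseteq> carrier G" using psubset.prems by blast
    ultimately obtain A where A: "A \<subseteq> F - N" "\<forall>a\<in>A. \<forall>a'\<in>A. a \<noteq> a' \<longrightarrow> r < len (inv a \<otimes> a')"
      "sum ?w (F - N) \<le> ?c * sum ?w A"
      by (elim psubset.IH[THEN exE] conjE) (assumption, rule that)
    have AG: "A \<subseteq> carrier G" and finA: "finite A"
      using A(1) psubset.prems psubset.hyps finite_subset by blast+
    have xA: "r < len (inv x \<otimes> a)" "r < len (inv a \<otimes> x)" if "a \<in> A" for a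
    proof -
      show "r < len (inv x \<otimes> a)" using that A(1) by (auto simp: N_def)
      then show "r < len (inv a \<otimes> x)" using that AG xG len_inv_mult_commute[of a x] by auto
    qed
    have "x \<notin> A" using xA[of x] r xG by auto
    have "card N \<le> card {g \<in> carrier G. len g \<le> r}"
    proof (rule card_inj_on_le[of "\<lambda>g. inv x \<otimes> g"])
      show "inj_on (\<lambda>g. inv x \<otimes> g) N"
        using xG psubset.prems by (intro inj_on_inverseI[of _ "\<lambda>y. x \<otimes> y"]) (auto simp: N_def)
      show "(\<lambda>g. inv x \<otimes> g) ` N \<subseteq> {g \<in> carrier G. len g \<le> r}"
        using xG psubset.prems by (auto simp: N_def)
    qed (rule finite_ball)
    have "sum ?w N \<le> (\<Sum>g\<in>N. exp (\<sigma> * r) * ?w x)"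
    proof (rule sum_mono)
      fix g assume g: "g \<in> N"
      then have gG: "g \<in> carrier G" and "len (inv g \<otimes> x) \<le> r"
        using psubset.prems xG len_inv_mult_commute[of x g] by (auto simp: N_def)
      then have "len x \<le> len g + r" using len_mult[of g "inv g \<otimes> x"] xG by simp
      then have "\<sigma> * len x \<le> \<sigma> * (len g + r)" using \<sigma> by (rule mult_left_mono)
      then show "?w g \<le> exp (\<sigma> * r) * ?w x" by (simp add: algebra_simps flip: exp_add)
    qed
    also have "\<dots> = real (card N) * (exp (\<sigma> * r) * ?w x)" by simp
    also have "\<dots> \<le> ?c * ?w x"
      using \<open>card N \<le> _\<close> by (simp add: mult_right_mono)
    finally have "sum ?w N \<le> ?c * ?w x" .
    moreover have "sum ?w F = sum ?w N + sum ?w (F - N)"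
      using psubset.hyps by (subst sum.subset_diff[of N]) (auto simp: N_def)
    ultimately have "sum ?w F \<le> ?c * sum ?w (insert x A)"
      using A(3) finA \<open>x \<notin> A\<close> by (simp add: distrib_left)
    moreover have "insert x A \<subseteq> F" using A x by blast
    moreover have "\<forall>a\<in>insert x A. \<forall>a'\<in>insert x A. a \<noteq> a' \<longrightarrow> r < len (inv a \<otimes> a')"
      using A(2) xA by auto
    ultimately show ?thesis by blast
  qed simp
qed

end

section \<open>Words in blocks and their unique decoding\<close>

text \<open>The assumption \<open>A_separated\<close> says that \<open>a\<close> is determined by any geodesic from \<open>\<one>\<close> that passes
  near \<open>a\<close> and \<open>a u h\<close>, among the elements \<open>a'\<close> of \<open>A\<close> near which this geodesic passes.\<close>

locale extension_blocks = hyperbolic_length G len \<Delta> R for G (structure) and len \<Delta> R +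
  fixes U A :: "'a set" and h :: 'a and C K M :: real
  assumes U: "U \<subseteq> carrier G" "\<And>u. u \<in> U \<Longrightarrow> K \<le> len u" "\<And>u. u \<in> U \<Longrightarrow> len u \<le> M"
    and U_separated: "\<And>u v. u \<in> U \<Longrightarrow> v \<in> U \<Longrightarrow> u \<noteq> v \<Longrightarrow> gp u v \<le> C"
    and U_extend: "\<And>g k. g \<in> carrier G \<Longrightarrow> k \<in> carrier G \<Longrightarrow> \<exists>u\<in>U. gp (inv g) u \<le> C \<and> gp (inv u) k \<le> C"
    and h: "h \<in> carrier G" "K \<le> len h"
    and A: "A \<subseteq> carrier G" "finite A" "\<And>a. a \<in> A \<Longrightarrow> K \<le> len a"
    and C_nonneg: "0 \<le> C" and K_large: "2 * C + 3 * \<Delta> < K"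
    and A_separated: "\<And>a a' u. \<lbrakk>a \<in> A; a' \<in> A; u \<in> U; gp (inv a) u \<le> C; gp (inv u) h \<le> C;
        len a \<le> len a'; len a - C - 2 * \<Delta> \<le> gp a a';
        min (len (a \<otimes> u \<otimes> h)) (len a') - C - 3 * \<Delta> \<le> gp (a \<otimes> u \<otimes> h) a'\<rbrakk> \<Longrightarrow> a = a'"
begin

definition ext :: "'a \<Rightarrow> 'a \<Rightarrow> 'a" where
  "ext g k = (SOME u. u \<in> U \<and> gp (inv g) u \<le> C \<and> gp (inv u) k \<le> C)"

lemma ext:
  assumes "g \<in> carrier G" "k \<in> carrier G"
  shows "ext g k \<in> U" "gp (inv g) (ext g k) \<le> C" "gp (inv ext g k) k \<le> C" "ext g k \<in> carrier G"
proof -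
  have "\<exists>u. u \<in> U \<and> gp (inv g) u \<le> C \<and> gp (inv u) k \<le> C" using U_extend[OF assms] by blast
  then have "ext g k \<in> U \<and> gp (inv g) (ext g k) \<le> C \<and> gp (inv ext g k) k \<le> C"
    unfolding ext_def by (rule someI_ex)
  then show "ext g k \<in> U" "gp (inv g) (ext g k) \<le> C" "gp (inv ext g k) k \<le> C" "ext g k \<in> carrier G"
    using U by auto
qed

text \<open>Every block ends in \<open>h\<close>, so the joint \<open>ext h a\<close> in front of
  \<open>a\<close> fits whatever block precedes it. Each block thus depends on its own letter only,
  and blocks form an alphabet.\<close>

definition block :: "'a \<Rightarrow> 'a list" where
  "block a = [ext h a, a, ext a h, h]"

definition blocks :: "'a list \<Rightarrow> 'a list" where
  "blocks as = concat (map block as)"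

lemma blocks_simps [simp]:
  "blocks [] = []" "blocks (a # as) = ext h a # a # ext a h # h # blocks as"
  by (simp_all add: blocks_def block_def)

lemma blocks_closed: "set as \<subseteq> A \<Longrightarrow> set (blocks as) \<subseteq> carrier G"
  using h A ext by (induction as) auto

text \<open>The leading \<open>h\<close> stands for the last letter of a preceding block, which lets
  the induction cross the joint between blocks.\<close>

lemma broken_geodesic_blocks:
  assumes "set as \<subseteq> A"
  shows "broken_geodesic C K (h # blocks as)"
  using assms
proof (induction as)
  case (Cons a as)
  then have "a \<in> carrier G" "K \<le> len a" using A by auto
  then show ?case using Cons ext[of a h] ext[of h a] h U by simp
qed (use h in simp)

text \<open>The way to a product passes near every prefix of its word. Two different first joints
  would diverge too early to share an endpoint, so they agree and cancel. Then the way to the rest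
  passes near both first letters and near a u h for the shorter one, which is what
  \<open>A_separated\<close> forbids unless they agree.\<close>

lemma product_blocks_inj:
  assumes "length as = length bs" "set as \<subseteq> A" "set bs \<subseteq> A" "product (blocks as) = product (blocks bs)"
  shows "as = bs"
  using assms
proof (induction as bs rule: list_induct2)
  case (Cons a as b bs)
  define tail where "tail a z = a \<otimes> (ext a h \<otimes> (h \<otimes> z))" for a z
  define w where "w xs = product (blocks xs)" for xs
  have wcl: "w xs \<in> carrier G" if "set xs \<subseteq> A" for xs
    unfolding w_def using blocks_closed[OF that] by simp
  have wCons: "w (a # xs) = ext h a \<otimes> tail a (w xs)" for a xs
    by (simp add: w_def tail_def)
  have facts: "tail a (w xs) \<in> carrier G"
    "len (ext h a) - C - \<Delta> \<le> gp (ext h a) (w (a # xs))"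
    "len a - C - \<Delta> \<le> gp a (tail a (w xs))"
    "len (a \<otimes> ext a h \<otimes> h) - C - 2 * \<Delta> \<le> gp (a \<otimes> ext a h \<otimes> h) (tail a (w xs))"
    if a: "a \<in> A" and xs: "set xs \<subseteq> A" for a xs
  proof -
    have cl: "a \<in> carrier G" "ext h a \<in> carrier G" "ext a h \<in> carrier G" "w xs \<in> carrier G"
      using a A ext h wcl[OF xs] by auto
    show tcl: "tail a (w xs) \<in> carrier G" using cl h by (simp add: tail_def)
    have bg: "broken_geodesic C K (h # blocks (a # xs))"
      using broken_geodesic_blocks[of "a # xs"] a xs by simp
    have sub: "set (blocks (a # xs)) \<subseteq> carrier G" using blocks_closed[of "a # xs"] a xs by simp
    have K': "2 * C + 2 * \<Delta> < K" using K_large \<Delta>_nonneg by simp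
    have "gp (inv ext h a) (tail a (w xs)) \<le> C + \<Delta>"
      using broken_geodesic_head[of C K "ext h a" "a # ext a h # h # blocks xs"] bg sub K' C_nonneg
      by (simp add: tail_def w_def)
    then show "len (ext h a) - C - \<Delta> \<le> gp (ext h a) (w (a # xs))"
      using gp_mult_self[of "ext h a" "tail a (w xs)"] cl tcl by (simp add: wCons)
    have "gp (inv a) (ext a h \<otimes> (h \<otimes> w xs)) \<le> C + \<Delta>"
      using broken_geodesic_head[of C K a "ext a h # h # blocks xs"] bg sub K' C_nonneg
      by (simp add: w_def)
    then show "len a - C - \<Delta> \<le> gp a (tail a (w xs))"
      using gp_mult_self[of a "ext a h \<otimes> (h \<otimes> w xs)"] cl h by (simp add: tail_def)
    have "gp (inv h) (w xs) \<le> C + \<Delta>"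
      using broken_geodesic_head[of C K h "blocks xs"] broken_geodesic_blocks[OF xs] sub K' C_nonneg h
      by (simp add: w_def)
    then have "gp (inv (a \<otimes> ext a h \<otimes> h)) (w xs) \<le> C + 2 * \<Delta>"
      using cl h U ext[of a h] K_large by (intro broken_geodesic_three) auto
    moreover have "tail a (w xs) = (a \<otimes> ext a h \<otimes> h) \<otimes> w xs"
      using cl h by (simp add: tail_def m_assoc)
    ultimately show "len (a \<otimes> ext a h \<otimes> h) - C - 2 * \<Delta> \<le> gp (a \<otimes> ext a h \<otimes> h) (tail a (w xs))"
      using gp_mult_self[of "a \<otimes> ext a h \<otimes> h" "w xs"] cl h by simp
  qed
  have mem: "a \<in> A" "set as \<subseteq> A" "b \<in> A" "set bs \<subseteq> A" using Cons.prems by auto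
  have cl: "a \<in> carrier G" "b \<in> carrier G" "ext h a \<in> carrier G" "ext h b \<in> carrier G"
    "ext a h \<in> carrier G" "ext b h \<in> carrier G" "w as \<in> carrier G" "w bs \<in> carrier G"
    using mem A ext h wcl by auto
  note fa = facts[OF mem(1,2)] and fb = facts[OF mem(3,4)]
  have eq: "w (a # as) = w (b # bs)" using Cons.prems by (simp add: w_def)
  have "ext h a = ext h b"
  proof (rule ccontr)
    assume "ext h a \<noteq> ext h b"
    then have "gp (ext h a) (ext h b) \<le> C" using U_separated ext mem cl h by blast
    moreover have "gp (ext h a) (w (a # as)) - \<Delta> \<le> gp (ext h a) (ext h b) \<or>
        gp (w (a # as)) (ext h b) - \<Delta> \<le> gp (ext h a) (ext h b)"
      using cl mem wcl[of "a # as"] by (intro four_point) auto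
    moreover have "gp (w (a # as)) (ext h b) = gp (ext h b) (w (b # bs))"
      unfolding eq using cl mem wcl[of "b # bs"] by (simp add: gp_commute)
    moreover have "K \<le> len (ext h a)" "K \<le> len (ext h b)" using U ext cl h by auto
    ultimately show False using fa fb K_large \<Delta>_nonneg by auto
  qed
  then have tail_eq: "tail a (w as) = tail b (w bs)"
    using eq fa(1) fb(1) cl by (simp add: wCons)
  \<comment> \<open>Stated for arbitrary letters and tails, so that it serves with either of the two
    as the shorter letter. The minimum below is due to \<open>b'\<close> possibly ending before a' u
    h is reached.\<close>
  have ab: "a' = b'"
    if "a' \<in> A" "b' \<in> A" "set xs \<subseteq> A" "set ys \<subseteq> A" "tail a' (w xs) = tail b' (w ys)" "len a' \<le> len b'" for a' b' xs ys
  proof -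
    have cl: "a' \<in> carrier G" "b' \<in> carrier G" "ext a' h \<in> carrier G" using that A ext h by auto
    note f = facts[OF that(1,3)] and g = facts[OF that(2,4)]
    let ?y = "tail a' (w xs)"
    have com: "gp ?y b' = gp b' ?y" using cl f by (simp add: gp_commute)
    have "gp a' ?y - \<Delta> \<le> gp a' b' \<or> gp ?y b' - \<Delta> \<le> gp a' b'"
      using cl f by (intro four_point) auto
    then have 1: "len a' - C - 2 * \<Delta> \<le> gp a' b'" using f g that com by auto
    have "gp (a' \<otimes> ext a' h \<otimes> h) ?y - \<Delta> \<le> gp (a' \<otimes> ext a' h \<otimes> h) b' \<or>
        gp ?y b' - \<Delta> \<le> gp (a' \<otimes> ext a' h \<otimes> h) b'"
      using cl f h by (intro four_point) auto
    then have 2: "min (len (a' \<otimes> ext a' h \<otimes> h)) (len b') - C - 3 * \<Delta> \<le> gp (a' \<otimes> ext a' h \<otimes> h) b'"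
      using f g that com \<Delta>_nonneg by (auto simp: min_def)
    show ?thesis using A_separated[OF that(1,2) _ _ _ that(6) 1 2] ext[of a' h] cl h by blast
  qed
  have "a = b"
    using ab[of a b as bs] ab[of b a bs as] mem tail_eq by (cases "len a \<le> len b") auto
  moreover from this have "w as = w bs"
    using tail_eq cl h by (simp add: tail_def)
  then have "as = bs" using Cons.IH mem by (simp add: w_def)
  ultimately show ?case by simp
qed simp

lemma len_product_blocks:
  assumes "set as \<subseteq> A"
  shows "len (product (blocks as)) \<le> (\<Sum>a\<leftarrow>as. len a + (2 * M + len h))"
  using assms
proof (induction as)
  case (Cons a as)
  then have cl: "a \<in> carrier G" "ext h a \<in> U" "ext a h \<in> U" "product (blocks as) \<in> carrier G"
    "ext h a \<in> carrier G" "ext a h \<in> carrier G"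
    using A ext h blocks_closed by auto
  let ?z = "product (blocks as)"
  have "len (ext h a \<otimes> (a \<otimes> (ext a h \<otimes> (h \<otimes> ?z)))) \<le> len (ext h a) + (len a + (len (ext a h) + (len h + len ?z)))"
    using len_mult[of "ext h a" "a \<otimes> (ext a h \<otimes> (h \<otimes> ?z))"] len_mult[of a "ext a h \<otimes> (h \<otimes> ?z)"]
      len_mult[of "ext a h" "h \<otimes> ?z"] len_mult[of h ?z] cl h by simp
  then show ?case using Cons U(3)[OF cl(2)] U(3)[OF cl(3)] by simp
qed simp

text \<open>Otherwise the Poincare series of the group at \<open>s\<close> would have bounded
  partial sums. Different words of length \<open>n\<close> give different elements, so these sums
  dominate the n-th power of the letter sum, which is unbounded.\<close>

theorem growth_exceeds:
  assumes s: "0 \<le> s" "s' < s" and big: "1 < (\<Sum>a\<in>A. exp (- s * (len a + (2 * M + len h))))"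
  shows "\<exists>n::nat. Q * exp (s' * real n) < real (card {g \<in> carrier G. len g \<le> real n})"
proof (rule ccontr)
  assume "\<not> ?thesis"
  then have "\<And>n::nat. real (card {g \<in> carrier G. len g \<le> real n}) \<le> Q * exp (s' * real n)"
    by (simp add: not_less)
  then obtain Z where Z: "\<And>B. finite B \<Longrightarrow> B \<subseteq> carrier G \<Longrightarrow> (\<Sum>g\<in>B. exp (- s * len g)) \<le> Z"
    using poincare_series_bound[OF _ s] by blast
  let ?w = "\<lambda>a. exp (- s * (len a + (2 * M + len h)))"
  have "sum ?w A ^ n \<le> Z" for n
  proof -
    let ?L = "{as. set as \<subseteq> A \<and> length as = n}"
    let ?P = "\<lambda>as. product (blocks as)"
    have finL: "finite ?L" using A by (simp add: finite_lists_length_eq)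
    have "sum ?w A ^ n = (\<Sum>as\<in>?L. prod_list (map ?w as))"
      using A by (simp add: sum_prod_list_lists)
    also have "\<dots> \<le> (\<Sum>as\<in>?L. exp (- s * len (?P as)))"
    proof (rule sum_mono)
      fix as assume as: "as \<in> ?L"
      have "prod_list (map ?w as) = exp (- s * (\<Sum>a\<leftarrow>as. len a + (2 * M + len h)))"
        by (induction as) (simp_all add: algebra_simps flip: exp_add)
      then show "prod_list (map ?w as) \<le> exp (- s * len (?P as))"
        using len_product_blocks[of as] as s by (simp add: mult_left_mono)
    qed
    also have "\<dots> = (\<Sum>g\<in>?P ` ?L. exp (- s * len g))"
      using product_blocks_inj by (subst sum.reindex) (auto intro!: inj_onI)
    also have "\<dots> \<le> Z"
      using finL blocks_closed by (intro Z) auto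
    finally show ?thesis .
  qed
  moreover obtain n where "Z < sum ?w A ^ n" using real_arch_pow[OF big] by blast
  ultimately show False by (meson not_le)
qed

lemma K_pos: "0 < K"
  using K_large C_nonneg \<Delta>_nonneg by simp

lemma M_nonneg: "0 \<le> M"
proof -
  obtain u where "u \<in> U" using U_extend[of \<one> \<one>] by auto
  then show ?thesis using U len_nonneg[of u] order_trans by blast
qed

lemma growth_exceeds_strictly:
  assumes \<sigma>: "0 \<le> \<sigma>" and big: "1 < (\<Sum>a\<in>A. exp (- \<sigma> * (len a + (2 * M + len h))))"
  shows "\<exists>s'>\<sigma>. \<forall>Q. \<exists>n::nat. Q * exp (s' * real n) < real (card {g \<in> carrier G. len g \<le> real n})"
proof -
  let ?L = "2 * M + len h"
  define q where "q = (\<Sum>a\<in>A. exp (- \<sigma> * (len a + ?L)))"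
  define b where "b = Max (len ` A)"
  have "A \<noteq> {}" using big by auto
  then have b: "len a \<le> b" if "a \<in> A" for a using A that by (simp add: b_def)
  have "0 < b"
  proof -
    obtain a where "a \<in> A" using \<open>A \<noteq> {}\<close> by blast
    then show ?thesis using A(3)[of a] b[of a] K_pos by simp
  qed
  then have bL: "0 < b + ?L" using M_nonneg h K_pos by simp
  have q: "1 < q" using big by (simp add: q_def)
  \<comment> \<open>Raising the exponent by \<epsilon> costs each letter at most the factor
    \<open>exp (- \<epsilon> * (b + ?L))\<close>, here the inverse square root of \<open>q\<close>,
    so the letter sum stays above 1. The final exponent uses half of \<epsilon> to leave the strict
    gap that \<open>growth_exceeds\<close> asks for.\<close>
  define \<epsilon> where "\<epsilon> = ln q / (2 * (b + ?L))"
  have \<epsilon>: "0 < \<epsilon>" using q bL by (simp add: \<epsilon>_def)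
  have "1 < exp (ln q / 2)" using q by simp
  also have "\<dots> = exp (ln q - ln q / 2)" by simp
  also have "\<dots> = q * exp (- \<epsilon> * (b + ?L))"
    unfolding exp_diff exp_minus using q bL by (simp add: \<epsilon>_def divide_simps exp_minus)
  also have "\<dots> = (\<Sum>a\<in>A. exp (- \<sigma> * (len a + ?L)) * exp (- \<epsilon> * (b + ?L)))"
    by (simp add: q_def sum_distrib_right)
  also have "\<dots> \<le> (\<Sum>a\<in>A. exp (- (\<sigma> + \<epsilon>) * (len a + ?L)))"
  proof (rule sum_mono)
    fix a assume "a \<in> A"
    then have "\<epsilon> * len a \<le> \<epsilon> * b" using b \<epsilon> by simp
    then show "exp (- \<sigma> * (len a + ?L)) * exp (- \<epsilon> * (b + ?L)) \<le> exp (- (\<sigma> + \<epsilon>) * (len a + ?L))"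
      by (simp add: algebra_simps flip: exp_add)
  qed
  finally have "1 < (\<Sum>a\<in>A. exp (- (\<sigma> + \<epsilon>) * (len a + ?L)))" .
  then have "\<exists>n::nat. Q * exp ((\<sigma> + \<epsilon> / 2) * real n) < real (card {g \<in> carrier G. len g \<le> real n})" for Q
    using \<sigma> \<epsilon> by (intro growth_exceeds[where s = "\<sigma> + \<epsilon>"]) auto
  then show ?thesis using \<epsilon> by (intro exI[of _ "\<sigma> + \<epsilon> / 2"]) simp
qed

end

section \<open>Growth of the quotient by a normal subgroup\<close>

locale normal_hyperbolic_length = hyperbolic_length G len \<Delta> R + normal \<Gamma> G
  for G (structure) and len \<Delta> R and \<Gamma>
begin

text \<open>For the length of an action, the shortest length in \<Gamma> g is the distance between
  the orbits of b and g b: this is the ball of the quotient, counted in cosets.\<close>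

definition quotient_ball :: "real \<Rightarrow> 'a set set" where
  "quotient_ball r = {c \<in> rcosets \<Gamma>. len (shortest c) \<le> r}"

definition N :: "real \<Rightarrow> real" where
  "N r = real (card (quotient_ball r))"

lemma shortest_coset:
  assumes "c \<in> rcosets \<Gamma>"
  shows "shortest c \<in> c" "shortest c \<in> carrier G" "\<Gamma> #> shortest c = c" "k \<in> c \<Longrightarrow> len (shortest c) \<le> len k"
proof -
  have c: "c \<subseteq> carrier G" "c \<noteq> {}" using assms rcosets_carrier rcosets_non_empty by auto
  show "shortest c \<in> c" "k \<in> c \<Longrightarrow> len (shortest c) \<le> len k" using shortest[OF c] by auto
  then show "shortest c \<in> carrier G" using c by auto
  obtain x where x: "x \<in> carrier G" "c = \<Gamma> #> x" using assms by (auto simp: RCOSETS_def)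
  show "\<Gamma> #> shortest c = c"
    using repr_independence[of "shortest c" \<Gamma> x] \<open>shortest c \<in> c\<close> x subgroup_axioms by simp
qed

lemma len_shortest_coset:
  assumes "g \<in> carrier G"
  shows "\<Gamma> #> g \<in> rcosets \<Gamma>" "len (shortest (\<Gamma> #> g)) \<le> len g"
proof -
  show 1: "\<Gamma> #> g \<in> rcosets \<Gamma>" using assms by (auto simp: RCOSETS_def)
  show "len (shortest (\<Gamma> #> g)) \<le> len g"
    using shortest_coset(4)[OF 1] rcos_self[OF assms subgroup_axioms] by blast
qed

lemma inj_on_shortest: "inj_on shortest (rcosets \<Gamma>)"
  by (rule inj_on_inverseI[of _ "\<lambda>g. \<Gamma> #> g"]) (rule shortest_coset(3))

lemma finite_quotient_ball: "finite (quotient_ball r)"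
proof (rule finite_imageD)
  show "finite (shortest ` quotient_ball r)"
    by (rule finite_subset[OF _ finite_ball[of r]]) (auto simp: quotient_ball_def shortest_coset)
  show "inj_on shortest (quotient_ball r)"
    by (rule inj_on_subset[OF inj_on_shortest]) (auto simp: quotient_ball_def)
qed

lemma N_mono: "r \<le> r' \<Longrightarrow> N r \<le> N r'"
  unfolding N_def using finite_quotient_ball[of r'] by (intro of_nat_mono card_mono) (auto simp: quotient_ball_def)

lemma N_ge_one: "0 \<le> r \<Longrightarrow> 1 \<le> N r"
proof -
  assume "0 \<le> r"
  then have "\<Gamma> #> \<one> \<in> quotient_ball r"
    using len_shortest_coset[of \<one>] by (auto simp: quotient_ball_def)
  then have "card (quotient_ball r) \<noteq> 0" using finite_quotient_ball by auto
  then show "1 \<le> N r" by (simp add: N_def)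
qed

text \<open>A shortest representative is cut near distance \<open>r\<close>, and its coset is the
  product of the cosets of the two halves. Each half carries the error \<open>R\<close> of the
  cut.\<close>

lemma N_add_le:
  assumes "0 \<le> r" "0 \<le> t"
  shows "N (r + t) \<le> N (r + R) * N (t + R)"
proof -
  have "\<exists>k. k \<in> carrier G \<and> len k \<le> r + R \<and> len (inv k \<otimes> shortest c) \<le> t + R"
    if c: "c \<in> quotient_ball (r + t)" for c
  proof -
    have g: "shortest c \<in> carrier G" "len (shortest c) \<le> r + t"
      using c shortest_coset by (auto simp: quotient_ball_def)
    then show ?thesis
      using coarse_geodesic[of "shortest c" "min r (len (shortest c))"] assms len_nonneg[of "shortest c"]
      by (fastforce simp: min_def split: if_splits)
  qed
  then obtain \<kappa> where \<kappa>: "\<And>c. c \<in> quotient_ball (r + t) \<Longrightarrow>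
      \<kappa> c \<in> carrier G \<and> len (\<kappa> c) \<le> r + R \<and> len (inv \<kappa> c \<otimes> shortest c) \<le> t + R"
    by metis
  let ?f = "\<lambda>c. (\<Gamma> #> \<kappa> c, \<Gamma> #> (inv \<kappa> c \<otimes> shortest c))"
  have sc: "shortest c \<in> carrier G" "c \<in> rcosets \<Gamma>" if "c \<in> quotient_ball r" for c r
    using that shortest_coset by (auto simp: quotient_ball_def)
  have "card (quotient_ball (r + t)) \<le> card (quotient_ball (r + R) \<times> quotient_ball (t + R))"
  proof (rule card_inj_on_le[of ?f])
    show "inj_on ?f (quotient_ball (r + t))"
    proof (rule inj_on_inverseI[of _ "\<lambda>(p, q). p <#> q"])
      fix c assume c: "c \<in> quotient_ball (r + t)"
      then show "(\<lambda>(p, q). p <#> q) (?f c) = c"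
        using \<kappa>[OF c] sc[OF c] shortest_coset(3) by (simp add: rcos_sum)
    qed
    show "?f ` quotient_ball (r + t) \<subseteq> quotient_ball (r + R) \<times> quotient_ball (t + R)"
    proof (rule image_subsetI)
      fix c assume c: "c \<in> quotient_ball (r + t)"
      note k = \<kappa>[OF c] sc[OF c]
      then have "len (shortest (\<Gamma> #> \<kappa> c)) \<le> r + R"
        "len (shortest (\<Gamma> #> (inv \<kappa> c \<otimes> shortest c))) \<le> t + R"
        using len_shortest_coset(2)[of "\<kappa> c"] len_shortest_coset(2)[of "inv \<kappa> c \<otimes> shortest c"] by auto
      then show "?f c \<in> quotient_ball (r + R) \<times> quotient_ball (t + R)"
        using k len_shortest_coset(1) by (simp add: quotient_ball_def)
    qed
  qed (simp add: finite_quotient_ball)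
  then show ?thesis
    unfolding N_def by (simp only: card_cartesian_product flip: of_nat_mult of_nat_le_iff)
qed

section \<open>The exponent of the quotient and divergence of its series\<close>

text \<open>The shift absorbs the cutting errors: m + n + 2 R splits as (m + R) + (n + R), and each
  part grows by \<open>R\<close> once more. This makes \<open>M\<close> exactly
  submultiplicative.\<close>

definition M :: "nat \<Rightarrow> real" where
  "M n = N (real n + 2 * R)"

lemma M_ge_one: "1 \<le> M n"
  unfolding M_def using R_nonneg by (intro N_ge_one) simp

lemma M_add_le: "M (m + n) \<le> M m * M n"
  using N_add_le[of "real m + R" "real n + R"] R_nonneg by (simp add: M_def algebra_simps)

lemma M_mult_le: "M (m * q + r) \<le> M m ^ q * M r"
proof (induction q)
  case (Suc q)
  have "M (m * Suc q + r) \<le> M m * M (m * q + r)"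
    using M_add_le[of m "m * q + r"] by (simp add: algebra_simps)
  also have "\<dots> \<le> M m * (M m ^ q * M r)"
    using Suc M_ge_one[of m] by (intro mult_left_mono) auto
  finally show ?case by (simp add: mult_ac)
qed simp

definition \<sigma> :: real where
  "\<sigma> = (INF n\<in>{1..}. ln (M n) / real n)"

lemma \<sigma>_bdd: "bdd_below ((\<lambda>n. ln (M n) / real n) ` {1..})"
  using M_ge_one by (intro bdd_belowI[of _ 0]) auto

lemma \<sigma>_nonneg: "0 \<le> \<sigma>"
  unfolding \<sigma>_def using M_ge_one by (intro cINF_greatest) auto

lemma M_ge_exp: "exp (\<sigma> * real n) \<le> M n"
proof (cases "n = 0")
  case False
  then have "\<sigma> \<le> ln (M n) / real n"
    unfolding \<sigma>_def by (intro cINF_lower \<sigma>_bdd) auto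
  then have "\<sigma> * real n \<le> ln (M n)" using False by (simp add: field_simps)
  then have "exp (\<sigma> * real n) \<le> exp (ln (M n))" by simp
  then show ?thesis using M_ge_one[of n] by simp
qed (use M_ge_one in simp)

lemma N_le_exp:
  assumes "0 < \<epsilon>"
  shows "\<exists>Q>0. \<forall>n. N (real n) \<le> Q * exp ((\<sigma> + \<epsilon>) * real n)"
proof -
  have "\<exists>m\<in>{1..}. ln (M m) / real m < \<sigma> + \<epsilon>"
    using cINF_less_iff[OF _ \<sigma>_bdd, of "\<sigma> + \<epsilon>"] assms unfolding \<sigma>_def by auto
  then obtain m where m: "1 \<le> m" "ln (M m) / real m < \<sigma> + \<epsilon>" by auto
  then have "ln (M m) \<le> (\<sigma> + \<epsilon>) * real m" by (simp add: field_simps)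
  then have "exp (ln (M m)) \<le> exp ((\<sigma> + \<epsilon>) * real m)" by simp
  then have Mm: "M m \<le> exp ((\<sigma> + \<epsilon>) * real m)" using M_ge_one[of m] by simp
  define Q where "Q = M m"
  have "N (real n) \<le> Q * exp ((\<sigma> + \<epsilon>) * real n)" for n
  proof -
    \<comment> \<open>Fekete's argument: \<open>n\<close> is divided by \<open>m\<close>, and the
      remainder costs only the constant \<open>M m\<close>.\<close>
    have "M (n mod m) \<le> M m" unfolding M_def using m by (intro N_mono) (simp add: less_imp_le)
    have "N (real n) \<le> M n" unfolding M_def using R_nonneg by (intro N_mono) simp
    also have "\<dots> \<le> M m ^ (n div m) * M (n mod m)" using M_mult_le[of m "n div m" "n mod m"] by simp
    also have "\<dots> \<le> exp ((\<sigma> + \<epsilon>) * real m) ^ (n div m) * M m"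
      using Mm M_ge_one[of m] \<open>M (n mod m) \<le> M m\<close> M_ge_one[of "n mod m"]
      by (intro mult_mono power_mono) auto
    also have "exp ((\<sigma> + \<epsilon>) * real m) ^ (n div m) = exp ((\<sigma> + \<epsilon>) * real (m * (n div m)))"
      by (simp add: mult_ac flip: exp_of_nat_mult)
    also have "\<dots> \<le> exp ((\<sigma> + \<epsilon>) * real n)"
      using \<sigma>_nonneg assms by (simp only: exp_le_cancel_iff) (intro mult_left_mono of_nat_mono; simp)
    finally show ?thesis using M_ge_one[of m] by (simp add: Q_def mult_ac)
  qed
  then show ?thesis using M_ge_one[of m] by (intro exI[of _ Q]) (auto simp: Q_def)
qed

definition annulus :: "real \<Rightarrow> real \<Rightarrow> 'a set" where
  "annulus r t = shortest ` {c \<in> rcosets \<Gamma>. r < len (shortest c) \<and> len (shortest c) \<le> t}"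

lemma finite_annulus: "finite (annulus r t)" and annulus_closed: "annulus r t \<subseteq> carrier G"
proof -
  show "annulus r t \<subseteq> carrier G" using shortest_coset by (auto simp: annulus_def)
  show "finite (annulus r t)"
    by (rule finite_subset[OF _ finite_ball[of t]]) (auto simp: annulus_def shortest_coset)
qed

text \<open>At radius t = n + 2 R the whole ball has at least \<open>exp (\<sigma> * n)\<close>
  cosets, so weighting each by \<open>exp (- \<sigma> * t)\<close> gives twice the claimed bound.
  For large \<open>n\<close> the inner ball takes at most half of that. The bound does not depend on
  \<open>r\<close>, so it can be collected again further out.\<close>

lemma annulus_sum_ge:
  assumes \<sigma>: "0 < \<sigma>"
  shows "\<exists>t\<ge>r. exp (- 2 * R * \<sigma>) / 2 \<le> (\<Sum>g\<in>annulus r t. exp (- \<sigma> * len g))"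
proof -
  define \<kappa> where "\<kappa> = exp (- 2 * R * \<sigma>) / 2"
  have \<kappa>: "0 < \<kappa>" by (simp add: \<kappa>_def)
  \<comment> \<open>The summand 1 keeps the argument of the logarithm positive: \<open>N r\<close>
    vanishes for negative \<open>r\<close>.\<close>
  define n where "n = nat \<lceil>max r ((ln (N r + 1) - ln \<kappa>) / \<sigma>)\<rceil>"
  have n: "max r ((ln (N r + 1) - ln \<kappa>) / \<sigma>) \<le> real n" unfolding n_def by (rule real_nat_ceiling_ge)
  define t where "t = real n + 2 * R"
  have t: "r \<le> t" using n R_nonneg by (simp add: t_def)
  have N0: "0 \<le> N r" by (simp add: N_def)
  have "(ln (N r + 1) - ln \<kappa>) / \<sigma> \<le> t" using n R_nonneg by (simp add: t_def)
  then have "ln (N r + 1) - ln \<kappa> \<le> \<sigma> * t" using \<sigma> by (simp add: field_simps)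
  then have "ln (N r + 1) - \<sigma> * t \<le> ln \<kappa>" by simp
  then have "exp (ln (N r + 1) - \<sigma> * t) \<le> exp (ln \<kappa>)" by (simp only: exp_le_cancel_iff)
  then have "(N r + 1) * exp (- \<sigma> * t) \<le> \<kappa>" using \<kappa> N0 by (simp add: exp_diff exp_minus divide_inverse)
  then have small: "N r * exp (- \<sigma> * t) \<le> \<kappa>" by (simp add: distrib_right) (smt (verit) exp_gt_zero)
  have "2 * \<kappa> = exp (\<sigma> * real n) * exp (- \<sigma> * t)"
    by (simp add: \<kappa>_def t_def algebra_simps flip: exp_add)
  also have "\<dots> \<le> N t * exp (- \<sigma> * t)"
    using M_ge_exp[of n] by (intro mult_right_mono) (auto simp: M_def t_def)
  finally have big: "2 * \<kappa> \<le> N t * exp (- \<sigma> * t)" .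
  let ?D = "{c \<in> rcosets \<Gamma>. r < len (shortest c) \<and> len (shortest c) \<le> t}"
  have injD: "inj_on shortest ?D" by (rule inj_on_subset[OF inj_on_shortest]) auto
  have "quotient_ball t = quotient_ball r \<union> ?D" using t by (auto simp: quotient_ball_def)
  moreover have "finite ?D"
    by (rule finite_subset[OF _ finite_quotient_ball[of t]]) (auto simp: quotient_ball_def)
  moreover have "quotient_ball r \<inter> ?D = {}" by (auto simp: quotient_ball_def)
  ultimately have "N t = N r + real (card ?D)"
    using card_Un_disjoint[OF finite_quotient_ball[of r], of ?D] by (simp add: N_def)
  moreover have "real (card ?D) * exp (- \<sigma> * t) \<le> (\<Sum>g\<in>annulus r t. exp (- \<sigma> * len g))"
  proof -
    have "real (card ?D) * exp (- \<sigma> * t) = (\<Sum>g\<in>annulus r t. exp (- \<sigma> * t))"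
      using card_image[OF injD] by (simp add: annulus_def)
    also have "\<dots> \<le> (\<Sum>g\<in>annulus r t. exp (- \<sigma> * len g))"
      using \<sigma> by (intro sum_mono) (auto simp: annulus_def)
    finally show ?thesis .
  qed
  ultimately have "2 * \<kappa> \<le> N r * exp (- \<sigma> * t) + (\<Sum>g\<in>annulus r t. exp (- \<sigma> * len g))"
    using big by (simp add: distrib_right)
  then show ?thesis using small t unfolding \<kappa>_def by (intro exI[of _ t]) auto
qed

lemma annulus_sum_unbounded:
  assumes \<sigma>: "0 < \<sigma>"
  shows "\<exists>t\<ge>r. W \<le> (\<Sum>g\<in>annulus r t. exp (- \<sigma> * len g))"
proof -
  define \<kappa> where "\<kappa> = exp (- 2 * R * \<sigma>) / 2"
  have step: "\<exists>t\<ge>r. real j * \<kappa> \<le> (\<Sum>g\<in>annulus r t. exp (- \<sigma> * len g))" for j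
  proof (induction j)
    case 0
    show ?case by (intro exI[of _ r]) (auto intro: sum_nonneg)
  next
    case (Suc j)
    then obtain t where t: "r \<le> t" "real j * \<kappa> \<le> (\<Sum>g\<in>annulus r t. exp (- \<sigma> * len g))" by blast
    obtain t' where t': "t \<le> t'" "\<kappa> \<le> (\<Sum>g\<in>annulus t t'. exp (- \<sigma> * len g))"
      using annulus_sum_ge[OF \<sigma>] unfolding \<kappa>_def by blast
    have "annulus r t' = annulus r t \<union> annulus t t'" "annulus r t \<inter> annulus t t' = {}"
      using t t' by (force simp: annulus_def)+
    then have "(\<Sum>g\<in>annulus r t'. exp (- \<sigma> * len g)) =
        (\<Sum>g\<in>annulus r t. exp (- \<sigma> * len g)) + (\<Sum>g\<in>annulus t t'. exp (- \<sigma> * len g))"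
      by (simp add: sum.union_disjoint finite_annulus)
    then show ?case using t t' by (intro exI[of _ t']) (simp add: algebra_simps)
  qed
  obtain j where "W < real j * \<kappa>" using reals_Archimedean3[of \<kappa>] by (auto simp: \<kappa>_def)
  then show ?thesis using step[of j] by force
qed

text \<open>A shortest coset representative cannot travel along a translate of a long element of
  \<open>\<Gamma>\<close>: conjugating that element shows how to cut the detour without leaving the coset.\<close>

lemma shortest_avoids:
  assumes a: "a \<in> annulus r t" and w: "w \<in> carrier G" and h: "h \<in> \<Gamma>"
    and along: "len (w \<otimes> h) - e \<le> gp (w \<otimes> h) a"
  shows "len (w \<otimes> h) \<le> len w + 2 * e"
proof -
  have hG: "h \<in> carrier G" using h subset by auto
  obtain c where c: "c \<in> rcosets \<Gamma>" "a = shortest c" using a by (auto simp: annulus_def)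
  have aG: "a \<in> carrier G" using c shortest_coset by auto
  define \<gamma> where "\<gamma> = w \<otimes> inv h \<otimes> inv w"
  have "\<gamma> \<in> \<Gamma>" unfolding \<gamma>_def using inv_op_closed2[OF w] h by simp
  moreover have "c = \<Gamma> #> a" using c shortest_coset by auto
  ultimately have "\<gamma> \<otimes> a \<in> c" by (auto simp: r_coset_def)
  then have "len a \<le> len (\<gamma> \<otimes> a)" using c shortest_coset by auto
  moreover have "\<gamma> \<otimes> a = w \<otimes> (inv (w \<otimes> h) \<otimes> a)"
    using w hG aG by (simp add: \<gamma>_def inv_mult_group m_assoc)
  moreover have "len (w \<otimes> (inv (w \<otimes> h) \<otimes> a)) \<le> len w + len (inv (w \<otimes> h) \<otimes> a)"
    using w hG aG by (intro len_mult) auto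
  moreover have "len (inv (w \<otimes> h) \<otimes> a) = len (w \<otimes> h) + len a - 2 * gp (w \<otimes> h) a"
    using w hG aG by (intro len_inv_mult_eq) auto
  ultimately show ?thesis using along by simp
qed

theorem quotient_growth_less:
  assumes nvc: "\<not> virtually_cyclic G" and inf: "infinite \<Gamma>"
  shows "\<exists>s'>\<sigma>. \<forall>Q. \<exists>n::nat. Q * exp (s' * real n) < real (card {g \<in> carrier G. len g \<le> real n})"
proof -
  obtain C where C: "0 \<le> C" and
    ex: "\<And>K. \<exists>U. finite U \<and> U \<subseteq> carrier G \<and> (\<forall>u\<in>U. K \<le> len u) \<and>
       (\<forall>u\<in>U. \<forall>v\<in>U. u \<noteq> v \<longrightarrow> gp u v \<le> C) \<and> (\<exists>u\<in>U. \<exists>v\<in>U. u \<noteq> v) \<and>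
       (\<forall>g\<in>carrier G. \<forall>k\<in>carrier G. \<exists>u\<in>U. gp (inv g) u \<le> C \<and> gp (inv u) k \<le> C)"
    by (rule exists_extension_set[OF nvc]) simp
  define K where "K = 2 * C + 3 * \<Delta> + 1"
  obtain U where U: "finite U" "U \<subseteq> carrier G" "\<And>u. u \<in> U \<Longrightarrow> K \<le> len u"
    "\<And>u v. u \<in> U \<Longrightarrow> v \<in> U \<Longrightarrow> u \<noteq> v \<Longrightarrow> gp u v \<le> C" "\<exists>u\<in>U. \<exists>v\<in>U. u \<noteq> v"
    "\<And>g k. g \<in> carrier G \<Longrightarrow> k \<in> carrier G \<Longrightarrow> \<exists>u\<in>U. gp (inv g) u \<le> C \<and> gp (inv u) k \<le> C"
  proof -
    obtain U where "finite U \<and> U \<subseteq> carrier G \<and> (\<forall>u\<in>U. K \<le> len u) \<and>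
       (\<forall>u\<in>U. \<forall>v\<in>U. u \<noteq> v \<longrightarrow> gp u v \<le> C) \<and> (\<exists>u\<in>U. \<exists>v\<in>U. u \<noteq> v) \<and>
       (\<forall>g\<in>carrier G. \<forall>k\<in>carrier G. \<exists>u\<in>U. gp (inv g) u \<le> C \<and> gp (inv u) k \<le> C)"
      using ex[of K] by (elim exE)
    then show thesis by (elim conjE, intro that[of U]) simp_all
  qed
  define m where "m = Max (len ` U)"
  have m: "len u \<le> m" if "u \<in> U" for u using U that by (simp add: m_def)
  have "0 \<le> m" using U(2,5) m len_nonneg order_trans by blast
  \<comment> \<open>4 C + 8 \<Delta> is the sum of two losses: 2 (C + \<Delta>) for the joint in
    front of \<open>h\<close>, and 2 (C + 3 \<Delta>) from \<open>shortest_avoids\<close>.\<close>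
  obtain h where h: "h \<in> \<Gamma>" "max K (4 * C + 8 * \<Delta>) < len h"
    using exists_long[OF inf subset] by blast
  have hG: "h \<in> carrier G" using h subset by auto
  have K: "2 * C + 3 * \<Delta> < K" by (simp add: K_def)
  show ?thesis
  \<comment> \<open>If \<sigma> vanishes, every letter weighs 1 and two letters suffice. Distinct
    elements of \<open>U\<close> diverge, which is all the separation needed.\<close>
  proof (cases "\<sigma> = 0")
    case True
    obtain u v where uv: "u \<in> U" "v \<in> U" "u \<noteq> v" using U(5) by blast
    interpret B: extension_blocks G len \<Delta> R U "{u, v}" h C K m
    proof unfold_locales
      fix a a' w
      assume a: "a \<in> {u, v}" "a' \<in> {u, v}" and gp: "len a - C - 2 * \<Delta> \<le> gp a a'"
      show "a = a'"
      proof (rule ccontr)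
        assume "a \<noteq> a'"
        then have "gp a a' \<le> C" using a uv U(4) by blast
        moreover have "K \<le> len a" using a uv U(3) by blast
        ultimately show False using gp by (simp add: K_def \<Delta>_nonneg) (smt (verit) \<Delta>_nonneg)
      qed
    qed (use U m h hG uv C K in auto)
    have "1 < (\<Sum>a\<in>{u, v}. exp (- \<sigma> * (len a + (2 * m + len h))))" using uv True by simp
    then show ?thesis using B.growth_exceeds_strictly True by auto
  next
    case False
    then have \<sigma>: "0 < \<sigma>" using \<sigma>_nonneg by simp
    \<comment> \<open>An upper bound for the distance from \<open>a\<close> to \<open>a'\<close>
      when the way to \<open>a'\<close> passes near \<open>a\<close> but \<open>a'\<close> is
      shorter than a u h.\<close>
    define r where "r = m + len h + 2 * C + 4 * \<Delta>"
    have r: "0 \<le> r" using \<open>0 \<le> m\<close> len_nonneg[OF hG] C \<Delta>_nonneg by (simp add: r_def)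
    define P where "P = real (card {g \<in> carrier G. len g \<le> r}) * exp (\<sigma> * r)"
    have P: "0 < P"
    proof -
      have "\<one> \<in> {g \<in> carrier G. len g \<le> r}" using r by simp
      then have "card {g \<in> carrier G. len g \<le> r} > 0" using finite_ball card_gt_0_iff by blast
      then show ?thesis by (simp add: P_def)
    qed
    define E where "E = exp (- \<sigma> * (2 * m + len h))"
    \<comment> \<open>\<open>P\<close> is lost on passing to a separated set and \<open>E\<close> on
      inserting the joints and \<open>h\<close>; a letter sum of at least 2 remains.\<close>
    obtain t where t: "2 / E * P \<le> (\<Sum>g\<in>annulus K t. exp (- \<sigma> * len g))"
      using annulus_sum_unbounded[OF \<sigma>] by blast
    obtain A where A: "A \<subseteq> annulus K t" "\<forall>a\<in>A. \<forall>a'\<in>A. a \<noteq> a' \<longrightarrow> r < len (inv a \<otimes> a')"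
      "(\<Sum>g\<in>annulus K t. exp (- \<sigma> * len g)) \<le> P * (\<Sum>a\<in>A. exp (- \<sigma> * len a))"
      using weighted_net[OF finite_annulus annulus_closed \<sigma>_nonneg r, of K t, folded P_def]
      by (elim exE conjE) (rule that)
    have AG: "A \<subseteq> carrier G" using A annulus_closed by blast
    have "finite A" using A finite_annulus finite_subset by blast
    interpret B: extension_blocks G len \<Delta> R U A h C K m
    proof unfold_locales
      fix a a' u
      assume a: "a \<in> A" "a' \<in> A" and u: "u \<in> U" and au: "gp (inv a) u \<le> C" and uh: "gp (inv u) h \<le> C"
        and le: "len a \<le> len a'" and gp: "len a - C - 2 * \<Delta> \<le> gp a a'"
        and gp': "min (len (a \<otimes> u \<otimes> h)) (len a') - C - 3 * \<Delta> \<le> gp (a \<otimes> u \<otimes> h) a'"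
      have cl: "a \<in> carrier G" "a' \<in> carrier G" "u \<in> carrier G" using a u AG U by auto
      \<comment> \<open>Either \<open>a'\<close> reaches beyond a u h, and then it travels along a
        translate of \<open>h\<close>, which is impossible for a shortest representative; or it ends
        before, and then it is within \<open>r\<close> of \<open>a\<close>.\<close>
      show "a = a'"
      proof (cases "len (a \<otimes> u \<otimes> h) \<le> len a'")
        case True
        have "gp (inv (a \<otimes> u)) h \<le> C + \<Delta>"
          using cl hG U(3)[OF u] h K C \<Delta>_nonneg au uh
          by (intro broken_geodesic_three(1)[where z = \<one> and K = K]) auto
        moreover have "len (a \<otimes> u \<otimes> h) = len (a \<otimes> u) + len h - 2 * gp (inv (a \<otimes> u)) h"
          using cl hG by (intro len_mult_eq) auto
        moreover have "len (a \<otimes> u \<otimes> h) \<le> len (a \<otimes> u) + 2 * (C + 3 * \<Delta>)"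
          using True gp' A(1) a(2) cl h(1)
          by (intro shortest_avoids[where a = a' and r = K and t = t]) auto
        ultimately have False using h by simp
        then show ?thesis ..
      next
        case False
        have "len (a \<otimes> u \<otimes> h) \<le> len a + m + len h"
          using len_mult[of "a \<otimes> u" h] len_mult[of a u] m[OF u] cl hG by simp
        then have "len (inv a \<otimes> a') \<le> r"
          using len_inv_mult_eq[of a a'] cl gp le False by (simp add: r_def)
        then show ?thesis using A(2) a by force
      qed
    next
      fix a assume "a \<in> A"
      then show "K \<le> len a" using A(1) by (auto simp: annulus_def)
    qed (use U m h hG C K AG \<open>finite A\<close> in auto)
    have "2 / E * P \<le> (\<Sum>a\<in>A. exp (- \<sigma> * len a)) * P" using t A(3) by (simp only: mult.commute[of P])
    then have "2 / E \<le> (\<Sum>a\<in>A. exp (- \<sigma> * len a))" using P by (rule mult_right_le_imp_le)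
    then have "2 \<le> (\<Sum>a\<in>A. exp (- \<sigma> * len a)) * E" by (simp add: E_def field_simps)
    also have "\<dots> = (\<Sum>a\<in>A. exp (- \<sigma> * (len a + (2 * m + len h))))"
      by (simp add: sum_distrib_right E_def algebra_simps flip: exp_add)
    finally show ?thesis using \<sigma>_nonneg by (intro B.growth_exceeds_strictly) auto
  qed
qed

end

section \<open>From slim triangles to the four-point condition\<close>

lemma geodesic_point:
  assumes "geodesic Y d \<gamma> x y" "0 \<le> d x y" "t \<in> {0..d x y}"
  shows "\<gamma> t \<in> Y" "d x (\<gamma> t) = t" "d (\<gamma> t) y = d x y - t"
proof -
  have g: "\<gamma> 0 = x" "\<gamma> (d x y) = y" "\<gamma> ` {0..d x y} \<subseteq> Y"
    "\<And>s t. s \<in> {0..d x y} \<Longrightarrow> t \<in> {0..d x y} \<Longrightarrow> d (\<gamma> s) (\<gamma> t) = \<bar>s - t\<bar>"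
    using assms(1) by (auto simp: geodesic_def)
  show "\<gamma> t \<in> Y" using g(3) assms(3) by blast
  show "d x (\<gamma> t) = t" using g(4)[of 0 t] g(1) assms by auto
  show "d (\<gamma> t) y = d x y - t" using g(4)[of t "d x y"] g(2) assms by auto
qed

text \<open>In a slim triangle some point of the side opposite to \<open>p\<close> is close to both other sides,
  so its distance to \<open>p\<close> is, up to a constant, the Gromov product at \<open>p\<close> of the endpoints of that side.\<close>

lemma (in Metric_space) slim_dist_le_gromov_product:
  assumes geo: "geodesic M d \<alpha> x y" and p: "x \<in> M" "y \<in> M" "p \<in> M"
    and space: "geodesic_space M d"
    and slim: "\<And>\<beta> \<gamma> q. geodesic M d \<beta> y p \<Longrightarrow> geodesic M d \<gamma> x p \<Longrightarrow> q \<in> \<alpha> ` {0..d x y} \<Longrightarrow>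
      \<exists>q'\<in>\<beta> ` {0..d y p} \<union> \<gamma> ` {0..d x p}. d q q' \<le> \<delta>"
  shows "\<exists>q\<in>\<alpha> ` {0..d x y}. d p q \<le> (d x p + d y p - d x y) / 2 + 2 * \<delta> + 1"
proof -
  obtain \<beta> \<gamma> where \<beta>: "geodesic M d \<beta> y p" and \<gamma>: "geodesic M d \<gamma> x p"
    using space p unfolding geodesic_space_def by blast
  have \<alpha>0: "\<alpha> 0 = x" "\<alpha> (d x y) = y" and \<beta>0: "\<beta> 0 = y" and \<gamma>0: "\<gamma> 0 = x"
    using geo \<beta> \<gamma> by (auto simp: geodesic_def)
  have \<delta>: "0 \<le> \<delta>"
  proof -
    obtain q' where "d x q' \<le> \<delta>" using slim[OF \<beta> \<gamma>, of x] \<alpha>0 by force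
    then show ?thesis using nonneg[of x q'] by linarith
  qed
  \<comment> \<open>The parameters at which \<alpha> is close to \<gamma>. Near the supremum there
    is one such \<open>s\<close>, and at most 1 further an \<open>s'\<close> close to \<beta>; this
    step accounts for the summand 1 in the bound.\<close>
  define S where "S = {t \<in> {0..d x y}. \<exists>q\<in>\<gamma> ` {0..d x p}. d (\<alpha> t) q \<le> \<delta>}"
  have "0 \<in> S" using \<alpha>0 \<gamma>0 \<delta> p by (force simp: S_def)
  have bdd: "bdd_above S" by (intro bdd_aboveI[of _ "d x y"]) (auto simp: S_def)
  obtain s where s: "s \<in> S" "Sup S - 1 / 2 < s"
    using less_cSup_iff[of S "Sup S - 1 / 2"] \<open>0 \<in> S\<close> bdd by force
  define s' where "s' = min (s + 1) (d x y)"
  have s01: "0 \<le> s" "s \<le> d x y" "s' \<in> {0..d x y}" "\<bar>s - s'\<bar> \<le> 1"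
    using s by (auto simp: S_def s'_def)
  have dss': "d (\<alpha> s) (\<alpha> s') \<le> 1" using geo s01 by (auto simp: geodesic_def)
  have "\<exists>q\<in>\<beta> ` {0..d y p}. d (\<alpha> s') q \<le> \<delta>"
  proof (cases "s' = d x y")
    case True
    then show ?thesis using \<alpha>0 \<beta>0 \<delta> p by force
  next
    case False
    then have "Sup S < s'" using s by (auto simp: s'_def)
    then have "s' \<notin> S" using cSup_upper[OF _ bdd, of s'] by force
    moreover have "\<exists>q'\<in>\<beta> ` {0..d y p} \<union> \<gamma> ` {0..d x p}. d (\<alpha> s') q' \<le> \<delta>"
      using slim[OF \<beta> \<gamma>] s01 by blast
    ultimately show ?thesis using s01 by (auto simp: S_def)
  qed
  then obtain u where u: "u \<in> {0..d y p}" "d (\<alpha> s') (\<beta> u) \<le> \<delta>" by blast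
  obtain v where v: "v \<in> {0..d x p}" "d (\<alpha> s) (\<gamma> v) \<le> \<delta>" using s by (auto simp: S_def)
  note a = geodesic_point[OF geo, of s] geodesic_point[OF geo, of s']
  note b = geodesic_point[OF \<beta> _ u(1)] geodesic_point[OF \<gamma> _ v(1)]
  have M: "\<alpha> s \<in> M" "\<alpha> s' \<in> M" "\<beta> u \<in> M" "\<gamma> v \<in> M" using a b s01 by auto
  have "d p (\<alpha> s) \<le> d p (\<gamma> v) + d (\<gamma> v) (\<alpha> s)" "d x (\<alpha> s) \<le> d x (\<gamma> v) + d (\<gamma> v) (\<alpha> s)"
    "d p (\<alpha> s) \<le> d p (\<beta> u) + d (\<beta> u) (\<alpha> s)" "d y (\<alpha> s) \<le> d y (\<beta> u) + d (\<beta> u) (\<alpha> s)"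
    "d (\<beta> u) (\<alpha> s) \<le> d (\<beta> u) (\<alpha> s') + d (\<alpha> s') (\<alpha> s)"
    using M p by (auto intro: triangle)
  then have "d p (\<alpha> s) \<le> (d x p + d y p - d x y) / 2 + 2 * \<delta> + 1"
    using a b s01 u v dss' commute[of "\<gamma> v" "\<alpha> s"] commute[of "\<beta> u" "\<alpha> s'"] commute[of "\<alpha> s'" "\<alpha> s"]
      commute[of y "\<alpha> s"] commute[of "\<beta> u" p] commute[of "\<gamma> v" p] by (simp add: field_simps)
  then show ?thesis using s01 by auto
qed

lemma (in Metric_space) gromov_product_le_dist:
  assumes "geodesic M d \<alpha> x y" "q \<in> \<alpha> ` {0..d x y}" "x \<in> M" "y \<in> M" "p \<in> M"
  shows "(d x p + d y p - d x y) / 2 \<le> d p q"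
proof -
  obtain t where t: "q = \<alpha> t" "t \<in> {0..d x y}" using assms by auto
  note q = geodesic_point[OF assms(1) _ t(2)]
  have "d x p \<le> d x q + d q p" "d y p \<le> d y q + d q p"
    using triangle[of x q p] triangle[of y q p] q assms t by auto
  then show ?thesis using q t commute[of q p] commute[of q y] by simp
qed

text \<open>Some point of the side from x to z is about as close to p as the Gromov product of x and
  z at p. Slimness puts it near one of the other two sides, and no point of a side is closer to p
  than the Gromov product of its ends.\<close>

lemma (in Metric_space) four_point_of_slim:
  assumes space: "geodesic_space M d" and hyp: "gromov_hyperbolic M d"
  obtains \<Delta> where "0 \<le> \<Delta>" "\<And>x y z p. \<lbrakk>x \<in> M; y \<in> M; z \<in> M; p \<in> M\<rbrakk> \<Longrightarrow>
    min ((d x p + d y p - d x y) / 2) ((d y p + d z p - d y z) / 2) - \<Delta> \<le> (d x p + d z p - d x z) / 2"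
proof -
  obtain \<delta> where \<delta>: "0 \<le> \<delta>" and slim: "\<And>x y z \<alpha> \<beta> \<gamma> q. \<lbrakk>x \<in> M; y \<in> M; z \<in> M;
      geodesic M d \<alpha> x y; geodesic M d \<beta> y z; geodesic M d \<gamma> x z; q \<in> \<alpha> ` {0..d x y}\<rbrakk> \<Longrightarrow>
      \<exists>q'\<in>\<beta> ` {0..d y z} \<union> \<gamma> ` {0..d x z}. d q q' \<le> \<delta>"
    using hyp unfolding gromov_hyperbolic_def by meson
  have "min ((d x p + d y p - d x y) / 2) ((d y p + d z p - d y z) / 2) - (3 * \<delta> + 1)
      \<le> (d x p + d z p - d x z) / 2"
    if M: "x \<in> M" "y \<in> M" "z \<in> M" "p \<in> M" for x y z p
  proof -
    obtain \<alpha> \<beta> \<gamma> where g: "geodesic M d \<alpha> x z" "geodesic M d \<beta> z y" "geodesic M d \<gamma> x y"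
      using space M unfolding geodesic_space_def by meson
    obtain q where q: "q \<in> \<alpha> ` {0..d x z}" "d p q \<le> (d x p + d z p - d x z) / 2 + 2 * \<delta> + 1"
      using slim_dist_le_gromov_product[OF g(1) M(1,3,4) space slim[OF M(1,3,4) g(1)]] by blast
    have qM: "q \<in> M" using q(1) g(1) by (auto simp: geodesic_def)
    obtain q' where q': "q' \<in> \<beta> ` {0..d z y} \<union> \<gamma> ` {0..d x y}" "d q q' \<le> \<delta>"
      using slim[OF M(1,3,2) g q(1)] by blast
    have "q' \<in> M" using q'(1) g by (auto simp: geodesic_def)
    then have "d p q' \<le> d p q + d q q'" using M qM by (intro triangle)
    moreover have "(d z p + d y p - d z y) / 2 \<le> d p q' \<or> (d x p + d y p - d x y) / 2 \<le> d p q'"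
      using q'(1) gromov_product_le_dist[OF g(2) _ M(3,2,4)] gromov_product_le_dist[OF g(3) _ M(1,2,4)] by blast
    then have "min ((d x p + d y p - d x y) / 2) ((d y p + d z p - d y z) / 2) \<le> d p q'"
      using commute[of z y] by (auto simp: min_le_iff_disj add.commute)
    ultimately show ?thesis using q(2) q'(2) by argo
  qed
  then show thesis by (intro that[of "3 * \<delta> + 1"]) (use \<delta> in auto)
qed

lemma hyperbolic_length_of_action:
  assumes G: "group G" and space: "geodesic_space Y d" and hyp: "gromov_hyperbolic Y d"
    and act: "geometric_action G Y d \<phi>" and b: "b \<in> Y"
  obtains \<Delta> R where "hyperbolic_length G (\<lambda>g. d b (\<phi> g b)) \<Delta> R"
proof -
  interpret group G by (rule G)
  interpret M: Metric_space Y d using space by (simp add: geodesic_space_def)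
  have ga: "group_action G Y \<phi>"
    and iso: "\<And>g x y. g \<in> carrier G \<Longrightarrow> x \<in> Y \<Longrightarrow> y \<in> Y \<Longrightarrow> d (\<phi> g x) (\<phi> g y) = d x y"
    and finite_orbit: "\<And>r. 0 \<le> r \<Longrightarrow> finite {g \<in> carrier G. d b (\<phi> g b) \<le> r}"
    using act b by (auto simp: geometric_action_def isometric_action_def proper_action_def)
  interpret A: group_action G Y \<phi> by (rule ga)
  have orb: "\<phi> g x \<in> Y" if "g \<in> carrier G" "x \<in> Y" for g x using that A.element_image by blast
  have comp: "\<phi> (g \<otimes>\<^bsub>G\<^esub> h) x = \<phi> g (\<phi> h x)" if "g \<in> carrier G" "h \<in> carrier G" "x \<in> Y" for g h x
    using A.composition_rule that by blast
  have one: "\<phi> \<one>\<^bsub>G\<^esub> x = x" if "x \<in> Y" for x using fun_cong[OF A.id_eq_one, of x] that by simp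
  have dist: "d b (\<phi> (inv\<^bsub>G\<^esub> g \<otimes>\<^bsub>G\<^esub> h) b) = d (\<phi> g b) (\<phi> h b)" if "g \<in> carrier G" "h \<in> carrier G" for g h
    using iso[of g b "\<phi> (inv\<^bsub>G\<^esub> g \<otimes>\<^bsub>G\<^esub> h) b"] that b comp[of g "inv\<^bsub>G\<^esub> g \<otimes>\<^bsub>G\<^esub> h" b] orb
    by (simp flip: m_assoc)
  obtain \<Delta> where \<Delta>: "0 \<le> \<Delta>" and four: "\<And>x y z p. \<lbrakk>x \<in> Y; y \<in> Y; z \<in> Y; p \<in> Y\<rbrakk> \<Longrightarrow>
    min ((d x p + d y p - d x y) / 2) ((d y p + d z p - d y z) / 2) - \<Delta> \<le> (d x p + d z p - d x z) / 2"
    by (rule M.four_point_of_slim[OF space hyp]) blast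
  obtain K where K: "compactin M.mtopology K" "(\<Union>g\<in>carrier G. \<phi> g ` K) = Y"
    using act by (auto simp: geometric_action_def cocompact_action_def)
  obtain c B where B: "K \<subseteq> M.mcball c B"
    using M.compactin_imp_mbounded[OF K(1)] unfolding M.mbounded_def by blast
  \<comment> \<open>Cocompactness enters through boundedness: \<open>K\<close> lies in a ball, so
    the translates of \<open>b\<close> come within \<open>R\<close> of every point.\<close>
  define R where "R = max 0 (d b c + B)"
  have near: "\<exists>g\<in>carrier G. d (\<phi> g b) y \<le> R" if "y \<in> Y" for y
  proof -
    have "y \<in> (\<Union>g\<in>carrier G. \<phi> g ` K)" using that by (simp only: K(2))
    then obtain g k where gk: "g \<in> carrier G" "k \<in> K" "y = \<phi> g k" by (elim UN_E imageE)
    then have k: "k \<in> Y" "c \<in> Y" "d c k \<le> B" using B by auto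
    then have "d b k \<le> d b c + d c k" using b by (intro M.triangle)
    then show ?thesis using gk k iso[of g b k] b by (intro bexI[of _ g]) (auto simp: R_def)
  qed
  have "hyperbolic_length G (\<lambda>g. d b (\<phi> g b)) \<Delta> R"
  proof unfold_locales
    show "d b (\<phi> \<one>\<^bsub>G\<^esub> b) = 0" using b one by simp
    show "d b (\<phi> (inv\<^bsub>G\<^esub> g) b) = d b (\<phi> g b)" if "g \<in> carrier G" for g
      using dist[of g "\<one>\<^bsub>G\<^esub>"] that b one M.commute by simp
    show "d b (\<phi> (g \<otimes>\<^bsub>G\<^esub> h) b) \<le> d b (\<phi> g b) + d b (\<phi> h b)" if "g \<in> carrier G" "h \<in> carrier G" for g h
      using M.triangle[of b "\<phi> g b" "\<phi> g (\<phi> h b)"] that b comp orb iso by simp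
    show "finite {g \<in> carrier G. d b (\<phi> g b) \<le> r}" for r
      using finite_orbit[of "max 0 r"] by (rule rev_finite_subset) auto
    show "0 \<le> \<Delta>" "0 \<le> R" using \<Delta> by (auto simp: R_def)
    show "min ((d b (\<phi> g b) + d b (\<phi> h b) - d b (\<phi> (inv\<^bsub>G\<^esub> g \<otimes>\<^bsub>G\<^esub> h) b)) / 2)
        ((d b (\<phi> h b) + d b (\<phi> k b) - d b (\<phi> (inv\<^bsub>G\<^esub> h \<otimes>\<^bsub>G\<^esub> k) b)) / 2) - \<Delta>
        \<le> (d b (\<phi> g b) + d b (\<phi> k b) - d b (\<phi> (inv\<^bsub>G\<^esub> g \<otimes>\<^bsub>G\<^esub> k) b)) / 2"
      if "g \<in> carrier G" "h \<in> carrier G" "k \<in> carrier G" for g h k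
      using four[of "\<phi> g b" "\<phi> h b" "\<phi> k b" b] that b orb
        M.commute[of "\<phi> g b" b] M.commute[of "\<phi> h b" b] M.commute[of "\<phi> k b" b] by (simp add: dist)
    show "\<exists>k\<in>carrier G. d b (\<phi> k b) \<le> t + R \<and> d b (\<phi> (inv\<^bsub>G\<^esub> k \<otimes>\<^bsub>G\<^esub> g) b) \<le> d b (\<phi> g b) - t + R"
      if g: "g \<in> carrier G" and t: "0 \<le> t" "t \<le> d b (\<phi> g b)" for g t
    proof -
      have gb: "\<phi> g b \<in> Y" using g b orb by blast
      then obtain \<gamma> where \<gamma>: "geodesic Y d \<gamma> b (\<phi> g b)" using space b unfolding geodesic_space_def by blast
      have z: "\<gamma> t \<in> Y" "d b (\<gamma> t) = t" "d (\<gamma> t) (\<phi> g b) = d b (\<phi> g b) - t"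
        using geodesic_point[OF \<gamma>, of t] t by auto
      obtain k where k: "k \<in> carrier G" "d (\<phi> k b) (\<gamma> t) \<le> R" using near z(1) by blast
      have kb: "\<phi> k b \<in> Y" using k b orb by blast
      have "d b (\<phi> k b) \<le> d b (\<gamma> t) + d (\<gamma> t) (\<phi> k b)" "d (\<phi> k b) (\<phi> g b) \<le> d (\<phi> k b) (\<gamma> t) + d (\<gamma> t) (\<phi> g b)"
        using M.triangle[of b "\<gamma> t" "\<phi> k b"] M.triangle[of "\<phi> k b" "\<gamma> t" "\<phi> g b"] b z kb gb by auto
      then show ?thesis
        using k z dist[OF k(1) g] M.commute[of "\<gamma> t" "\<phi> k b"] by (intro bexI[of _ k]) auto
    qed
  qed
  then show thesis by (rule that)
qed

section \<open>From exponential bounds to growth rates\<close>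

lemma limsup_ln_le:
  fixes f :: "nat \<Rightarrow> nat"
  assumes s: "0 \<le> s" and f: "\<And>\<epsilon>. 0 < \<epsilon> \<Longrightarrow> \<exists>Q. \<forall>n. real (f n) \<le> Q * exp ((s + \<epsilon>) * real n)"
  shows "limsup (\<lambda>n. ereal (ln (real (f n)) / real n)) \<le> ereal s"
proof (rule ereal_le_epsilon2)
  fix \<epsilon> :: real assume \<epsilon>: "0 < \<epsilon>"
  obtain Q0 where Q0: "\<And>n. real (f n) \<le> Q0 * exp ((s + \<epsilon> / 2) * real n)" using f[of "\<epsilon> / 2"] \<epsilon> by auto
  define Q where "Q = max 1 Q0"
  have Q: "real (f n) \<le> Q * exp ((s + \<epsilon> / 2) * real n)" for n
    by (rule order_trans[OF Q0]) (simp add: Q_def mult_right_mono)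
  define n0 where "n0 = nat \<lceil>2 * ln Q / \<epsilon>\<rceil> + 1"
  have "ereal (ln (real (f n)) / real n) \<le> ereal s + ereal \<epsilon>" if n: "n0 \<le> n" for n
  proof -
    have "2 * ln Q / \<epsilon> \<le> real n0" unfolding n0_def using real_nat_ceiling_ge[of "2 * ln Q / \<epsilon>"] by simp
    then have "2 * ln Q / \<epsilon> \<le> real n" using n by simp
    then have lnQ: "ln Q \<le> \<epsilon> / 2 * real n" using \<epsilon> by (simp add: field_simps)
    have npos: "0 < n" using n by (simp add: n0_def)
    have "ln (real (f n)) \<le> (s + \<epsilon>) * real n"
    proof (cases "f n = 0")
      case False
      then have "ln (real (f n)) \<le> ln (Q * exp ((s + \<epsilon> / 2) * real n))" using Q by (intro ln_mono) auto
      also have "\<dots> = ln Q + (s + \<epsilon> / 2) * real n" by (subst ln_mult) (auto simp: Q_def)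
      also have "\<dots> \<le> (s + \<epsilon>) * real n" using lnQ by (simp add: algebra_simps)
      finally show ?thesis .
    qed (use s \<epsilon> in simp)
    then show ?thesis using npos by (simp add: field_simps)
  qed
  then show "limsup (\<lambda>n. ereal (ln (real (f n)) / real n)) \<le> ereal s + ereal \<epsilon>"
    by (intro Limsup_bounded eventually_sequentiallyI[of n0])
qed

text \<open>One \<open>n\<close> for each \<open>Q\<close> suffices, since enlarging
  \<open>Q\<close> rules out any finite set of indices.\<close>

lemma limsup_ln_ge:
  fixes f :: "nat \<Rightarrow> nat"
  assumes s: "0 \<le> s" and f: "\<And>Q. \<exists>n. Q * exp (s * real n) < real (f n)" 
  shows "ereal s \<le> limsup (\<lambda>n. ereal (ln (real (f n)) / real n))"
proof (rule ccontr)
  assume "\<not> ?thesis"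
  then have "eventually (\<lambda>n. ereal (ln (real (f n)) / real n) < ereal s) sequentially"
    by (intro Limsup_lessD) simp
  then obtain n0 where n0: "\<And>n. n0 \<le> n \<Longrightarrow> ln (real (f n)) / real n < s"
    by (auto simp: eventually_sequentially)
  define Q where "Q = 1 + (\<Sum>n\<le>n0. real (f n))"
  have Q: "1 \<le> Q" by (simp add: Q_def sum_nonneg)
  have "real (f n) \<le> Q * exp (s * real n)" for n
  proof (cases "n \<le> n0")
    case True
    then have "real (f n) \<le> (\<Sum>n\<le>n0. real (f n))" by (intro member_le_sum) auto
    also have "\<dots> \<le> Q * 1" by (simp add: Q_def)
    also have "\<dots> \<le> Q * exp (s * real n)" using Q s by (intro mult_left_mono) auto
    finally show ?thesis .
  next
    case False
    show ?thesis
    proof (cases "f n = 0")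
      case False
      have "ln (real (f n)) \<le> s * real n" using n0[of n] \<open>\<not> n \<le> n0\<close> by (simp add: field_simps)
      then have "exp (ln (real (f n))) \<le> exp (s * real n)" by (simp only: exp_le_cancel_iff)
      also have "\<dots> \<le> Q * exp (s * real n)" using Q by simp
      finally show ?thesis using False by simp
    qed (use Q in simp)
  qed
  then show False using f[of Q] by (meson not_le)
qed

theorem corollary1p4:
  fixes G :: "('g, 'm) monoid_scheme"
    and Y :: "'a set" and d :: "'a \<Rightarrow> 'a \<Rightarrow> real"
    and \<phi> :: "'g \<Rightarrow> 'a \<Rightarrow> 'a" and b :: 'a
  assumes "group G"
    and "\<not> virtually_cyclic G"
    and "geodesic_space Y d"
    and "gromov_hyperbolic Y d"
    and "geometric_action G Y d \<phi>"
    and "b \<in> Y"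
  shows "growth_tight G d \<phi> b"
  unfolding growth_tight_def
proof (intro allI impI, elim conjE)
  fix \<Gamma> assume N: "\<Gamma> \<lhd> G" and inf: "infinite \<Gamma>"
  obtain \<Delta> R where hyp: "hyperbolic_length G (\<lambda>g. d b (\<phi> g b)) \<Delta> R"
    using hyperbolic_length_of_action assms by metis
  let ?len = "\<lambda>g. d b (\<phi> g b)"
  interpret H: normal_hyperbolic_length G ?len \<Delta> R \<Gamma>
    by (intro normal_hyperbolic_length.intro hyp N)
  have ga: "group_action G Y \<phi>"
    and iso: "\<And>g x y. g \<in> carrier G \<Longrightarrow> x \<in> Y \<Longrightarrow> y \<in> Y \<Longrightarrow> d (\<phi> g x) (\<phi> g y) = d x y"
    using assms(5) by (auto simp: geometric_action_def isometric_action_def)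
  interpret A: group_action G Y \<phi> by (rule ga)
  have orb: "\<phi> g x \<in> Y" if "g \<in> carrier G" "x \<in> Y" for g x using that A.element_image by blast
  have comp: "\<phi> (g \<otimes>\<^bsub>G\<^esub> h) x = \<phi> g (\<phi> h x)" if "g \<in> carrier G" "h \<in> carrier G" "x \<in> Y" for g h x
    using A.composition_rule that by blast
  have one: "\<phi> \<one>\<^bsub>G\<^esub> x = x" if "x \<in> Y" for x using fun_cong[OF A.id_eq_one, of x] that by simp
  have b: "b \<in> Y" by (rule assms)
  let ?ball = "\<lambda>n::nat. {g \<in> carrier G. ?len g \<le> real n}"

  have quot: "quotient_growth_rate G d \<phi> b \<Gamma> \<le> ereal H.\<sigma>"
    unfolding quotient_growth_rate_def growth_rate_def
  proof (rule limsup_ln_le[OF H.\<sigma>_nonneg])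
    fix \<epsilon> :: real assume "0 < \<epsilon>"
    then obtain Q where Q: "\<And>n. H.N (real n) \<le> Q * exp ((H.\<sigma> + \<epsilon>) * real n)"
      using H.N_le_exp by blast
    let ?p = "sub_orbit G \<phi> \<Gamma> b"
    let ?f = "\<lambda>C. quotient_action \<phi> C ?p"
    let ?B = "\<lambda>n. orbit_ball (G Mod \<Gamma>) (orbit_dist d) (quotient_action \<phi>) ?p n"
    \<comment> \<open>The distance from h b to k g b is the length of h^(-1) k g, which again lies
      in the coset of g. Hence every coset counted in the orbit ball lies in
      \<open>quotient_ball\<close>; cosets with the same orbit can only lower the count.\<close>
    have len_le: "?len (H.shortest C) \<le> orbit_dist d ?p (?f C)" if C: "C \<in> rcosets\<^bsub>G\<^esub> \<Gamma>" for C
    proof -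
      obtain g where g: "g \<in> carrier G" "C = \<Gamma> #>\<^bsub>G\<^esub> g" using C by (auto simp: RCOSETS_def)
      have fC: "?f C = sub_orbit G \<phi> \<Gamma> (\<phi> g b)"
        unfolding g(2) by (rule quotient_action_coset[OF ga N g(1) b])
      show ?thesis
        unfolding orbit_dist_def fC
      proof (rule cINF_greatest)
        show "?p \<times> sub_orbit G \<phi> \<Gamma> (\<phi> g b) \<noteq> {}" using inf by (auto simp: orbit_def)
        fix z assume "z \<in> ?p \<times> sub_orbit G \<phi> \<Gamma> (\<phi> g b)"
        then obtain h k where hk: "h \<in> \<Gamma>" "k \<in> \<Gamma>" "z = (\<phi> h b, \<phi> k (\<phi> g b))"
          by (auto simp: orbit_def)
        have cl: "h \<in> carrier G" "k \<in> carrier G" using hk H.subset by auto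
        let ?x = "(inv\<^bsub>G\<^esub> h \<otimes>\<^bsub>G\<^esub> k) \<otimes>\<^bsub>G\<^esub> g"
        have "?x \<in> C" using hk g by (auto simp: r_coset_def)
        then have "?len (H.shortest C) \<le> ?len ?x" using H.shortest_coset(4)[OF C] by blast
        also have "\<dots> = d (\<phi> h b) (\<phi> h (\<phi> ?x b))" using iso cl g b orb by simp
        also have "\<phi> h (\<phi> ?x b) = \<phi> k (\<phi> g b)"
        proof -
          have "\<phi> h (\<phi> ?x b) = \<phi> (h \<otimes>\<^bsub>G\<^esub> ?x) b" using comp cl g b by simp
          also have "h \<otimes>\<^bsub>G\<^esub> ?x = k \<otimes>\<^bsub>G\<^esub> g" using cl g by (simp add: H.m_assoc)
          finally show ?thesis using comp cl g b by simp
        qed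
        finally show "?len (H.shortest C) \<le> (case z of (x, y) \<Rightarrow> d x y)" using hk by simp
      qed
    qed
    have "real (card (?B n \<inter> (\<lambda>g. quotient_action \<phi> g ?p) ` carrier (G Mod \<Gamma>))) \<le> Q * exp ((H.\<sigma> + \<epsilon>) * real n)" for n
    proof -
      have "?B n \<inter> (\<lambda>g. quotient_action \<phi> g ?p) ` carrier (G Mod \<Gamma>) \<subseteq> ?f ` H.quotient_ball (real n)"
        using len_le by (force simp: orbit_ball_def FactGroup_def H.quotient_ball_def)
      then have "card (?B n \<inter> (\<lambda>g. quotient_action \<phi> g ?p) ` carrier (G Mod \<Gamma>)) \<le> card (H.quotient_ball (real n))"
        using H.finite_quotient_ball surj_card_le by blast
      then have "real (card (?B n \<inter> (\<lambda>g. quotient_action \<phi> g ?p) ` carrier (G Mod \<Gamma>))) \<le> H.N (real n)"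
        by (simp add: H.N_def)
      then show ?thesis using Q[of n] by (rule order_trans)
    qed
    then show "\<exists>Q. \<forall>n. real (card (?B n \<inter> (\<lambda>g. quotient_action \<phi> g ?p) ` carrier (G Mod \<Gamma>))) \<le> Q * exp ((H.\<sigma> + \<epsilon>) * real n)"
      by blast
  qed

  obtain s where s: "H.\<sigma> < s" "\<And>Q. \<exists>n::nat. Q * exp (s * real n) < real (card (?ball n))"
    using H.quotient_growth_less[OF assms(2) inf] by blast
  have "ereal s \<le> growth_rate G d \<phi> b (carrier G)"
    unfolding growth_rate_def
  proof (rule limsup_ln_ge)
    show "0 \<le> s" using s H.\<sigma>_nonneg by simp
    fix Q
    let ?O = "\<lambda>n. orbit_ball G d \<phi> b n \<inter> (\<lambda>g. \<phi> g b) ` carrier G"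
    \<comment> \<open>Growth rates count orbit points, while the bound for the group counts
      elements. The two differ by at most the order of the stabilizer of \<open>b\<close>, finite by
      properness, and this constant goes into \<open>Q\<close>.\<close>
    define Stab where "Stab = {g \<in> carrier G. ?len g \<le> 0}"
    have stab: "finite Stab" unfolding Stab_def by (rule H.finite_ball)
    have "\<one>\<^bsub>G\<^esub> \<in> Stab" by (simp add: Stab_def)
    then have stab_pos: "0 < card Stab" using stab card_gt_0_iff by blast
    have le: "card (?ball n) \<le> card (?O n) * card Stab" for n
    proof -
      define \<tau> where "\<tau> p = (SOME g. g \<in> carrier G \<and> \<phi> g b = p)" for p
      have \<tau>: "\<tau> (\<phi> g b) \<in> carrier G" "\<phi> (\<tau> (\<phi> g b)) b = \<phi> g b" if "g \<in> carrier G" for g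
        using someI[of "\<lambda>k. k \<in> carrier G \<and> \<phi> k b = \<phi> g b" g] that by (auto simp: \<tau>_def)
      have "?O n = (\<lambda>g. \<phi> g b) ` ?ball n" by (auto simp: orbit_ball_def)
      then have finO: "finite (?O n)" using H.finite_ball by simp
      let ?F = "\<lambda>g. (\<phi> g b, inv\<^bsub>G\<^esub> \<tau> (\<phi> g b) \<otimes>\<^bsub>G\<^esub> g)"
      have "card (?ball n) \<le> card (?O n \<times> Stab)"
      proof (rule card_inj_on_le[of ?F])
        show "inj_on ?F (?ball n)"
          by (rule inj_on_inverseI[of _ "\<lambda>(p, k). \<tau> p \<otimes>\<^bsub>G\<^esub> k"]) (use \<tau> in auto)
        show "?F ` ?ball n \<subseteq> ?O n \<times> Stab"
        proof (rule image_subsetI)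
          fix g assume g: "g \<in> ?ball n"
          then have gG: "g \<in> carrier G" by simp
          note t = \<tau>[OF gG]
          have "\<phi> (inv\<^bsub>G\<^esub> \<tau> (\<phi> g b) \<otimes>\<^bsub>G\<^esub> g) b = \<phi> (inv\<^bsub>G\<^esub> \<tau> (\<phi> g b)) (\<phi> (\<tau> (\<phi> g b)) b)"
            using comp gG t b by simp
          also have "\<dots> = b" using comp[of "inv\<^bsub>G\<^esub> \<tau> (\<phi> g b)" "\<tau> (\<phi> g b)" b] t b one by simp
          finally have "inv\<^bsub>G\<^esub> \<tau> (\<phi> g b) \<otimes>\<^bsub>G\<^esub> g \<in> Stab"
            using t gG H.len_one one[OF b] by (simp add: Stab_def)
          then show "?F g \<in> ?O n \<times> Stab" using g by (auto simp: orbit_ball_def)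
        qed
      qed (simp add: finO stab)
      then show ?thesis by (simp add: card_cartesian_product)
    qed
    obtain n where "(Q * real (card Stab)) * exp (s * real n) < real (card (?ball n))" using s(2) by blast
    also have "\<dots> \<le> real (card (?O n)) * real (card Stab)" using le[of n] by (simp flip: of_nat_mult)
    finally have "Q * exp (s * real n) < real (card (?O n))" using stab_pos by (simp add: mult_ac)
    then show "\<exists>n. Q * exp (s * real n) < real (card (?O n))" by blast
  qed
  then show "quotient_growth_rate G d \<phi> b \<Gamma> < growth_rate G d \<phi> b (carrier G)"
    using quot s(1) by (meson ereal_less_eq(3) le_less_trans less_le_trans less_ereal.simps(1))
qed

end
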